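(* Let $V,W$ be Banach spaces and let $\Theta(t,u)\in C^1(\mathbb{R}_+\times V, GL(V,W))$ be a continuously differentiable family of bijective bounded linear operators $V\to W$ with $$\|\Theta(t,u)\|\le B_1,\qquad \|\Theta(t,u)^{-1}\|\le B_2\qquad\text{for all } t\ge0,\ u\in V .$$ Consider the Cauchy problem $\frac{d}{dt}u=f(t,u)$, $u(0)=u_0$, with $f\in C^1(\mathbb{R}_+\times V)$ taking values in $V$, write $Df_t(u)=\frac{\partial f}{\partial u}(t,u)$, and suppose that $$\sup_{t\ge0,\ u\in V} M_{\Theta(t,u)}[Df_t(u)]\le\lambda .$$ Then: (1) $M_{\Theta(t,u)}[Df_t(u)] = M_W\left[\left(\frac{\partial\Theta}{\partial t}(t,u)+\Theta(t,u)Df_t(u)\right)\Theta(t,u)^{-1}\right]$. (2) For any two solutions $u_1(t),u_2(t)$ of the Cauchy problem, $$\|u_1(t)-u_2(t)\|\le B_1B_2\,e^{\lambda t}\|u_1(0)-u_2(0)\|,$$ with $B_1B_2=\kappa(\Theta)=\|\Theta\|\|\Theta^{-1}\|$ the condition number when $\Theta$ is constant. (3) If $\lambda<0$, then the Cauchy problem is an asymptotic contraction in $V$ with rate $\lambda$. (4) The asymptotic contraction rate $\lambda$ is invariant under the choice of the weight $\Theta(t,u)$: if $\Theta_a,\Theta_b$ are two $C^1$ families of bijective bounded linear operators from $V$ to Banach spaces $W_a, W_b$, each uniformly bounded together with its inverse, and the growth bound with exponent $\lambda$ holds (with some finite prefactor) in the norm weighted by $\Theta_a$, then the growth bound with the same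 exponent $\lambda$ holds (with some finite prefactor) in the norm weighted by $\Theta_b$.
   Context: $GL(V,W)$ is the set of bijective bounded linear operators $V\to W$. The weighted norm is $\|v\|_{\Theta(t,u)}=\|\Theta(t,u)v\|_W$. Semi-inner product on a normed space $X$: $[x,y]_X=\|x\|\lim_{h\to0^+}\frac{\|x+hy\|-\|x\|}{h}$. Weighted contraction rate of a (not necessarily bounded) linear operator $A$ with domain $D(A)$: $$M_{\Theta(t,u)}[A]=\sup_{v\neq0,\ v\in D(A)}\frac{[\Theta(t,u)v,\ (\frac{\partial\Theta}{\partial t}(t,u)+\Theta(t,u)A)v]_W}{\|v\|_{\Theta(t,u)}^2},$$ where $\frac{\partial\Theta}{\partial t}$ is the partial derivative in $t$; and $M_W[A]=\sup_{w\ne0}[w,Aw]_W/\|w\|_W^2$ is the unweighted rate. Asymptotic contraction: let $K$ be a closed convex subset of $V$ and $\phi(t,u_0)=u(t)$ the propagator induced by solutions of the Cauchy problem with $u(0)=u_0\in K$. The Cauchy problem is asymptotically contracting (on $K$; here $K=V$) if there exist $\lambda_0\in[0,1)$ and a function $\ell:\mathbb{R}_+\to[0,\infty)$ with $\ell(t)\to\lambda_0$ as $t\to\infty$ such that $\|\phi(t,u_0)-\phi(t,v_0)\|\le\ell(t)\|u_0-v_0\|$ for all $t\ge0$ and $u_0,v_0\in K$. It has rate $\lambda$ if there is a finite constant $C$ such that one can take $\ell(t)=Ce^{\lambda t}$. Growth bound with exponent $\lambda$ in the norm weighted by $\Theta$: there is a finite prefactor $C$ such that for every solution $u(t)$ of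 the Cauchy problem and every $\delta u(t)$ with $\frac{d}{dt}\delta u=Df_t(u(t))\delta u$, one has $\|\delta u(t)\|_{\Theta(t,u(t))}\le Ce^{\lambda t}\|\delta u(0)\|_{\Theta(0,u(0))}$ for all $t\ge0$.
   Formalization: In the hypothesis of (2) and (3), the partial derivative ∂Θ/∂t in M is replaced by the derivative along the flow, ∂Θ/∂t + D_uΘ[f(t,u)]; with the partial derivative alone (2) and (3) fail for weights depending on u. For Θ = Θ(t) the two agree. *)

theory Defs
  imports "HOL-Analysis.Analysis"
begin

definition C1_on :: "'a::real_normed_vector set \<Rightarrow> ('a \<Rightarrow> 'b::real_normed_vector) \<Rightarrow> bool" where
  "C1_on S F \<longleftrightarrow> (\<exists>F' :: 'a \<Rightarrow> 'a \<Rightarrow>\<^sub>L 'b.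
     (\<forall>x\<in>S. (F has_derivative blinfun_apply (F' x)) (at x within S)) \<and> continuous_on S F')"

definition GL :: "('v::real_normed_vector \<Rightarrow>\<^sub>L 'w::real_normed_vector) set" where
  "GL = {T. bij (blinfun_apply T)}"

text \<open>For Banach spaces the boundedness of the inverse is automatic (bounded inverse theorem). It is
  listed because \<^const>\<open>onorm\<close> is meaningful only for bounded linear maps.\<close>

definition bounded_weight ::
  "(real \<Rightarrow> 'v \<Rightarrow> ('v::real_normed_vector \<Rightarrow>\<^sub>L 'w::real_normed_vector)) \<Rightarrow> real \<Rightarrow> real \<Rightarrow> bool" where
  "bounded_weight \<Theta> B1 B2 \<longleftrightarrow>
     C1_on ({0..} \<times> UNIV) (\<lambda>(t, u). \<Theta> t u) \<and>
     (\<forall>t\<ge>0. \<forall>u. \<Theta> t u \<in> GL \<and> norm (\<Theta> t u) \<le> B1 \<and>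
        bounded_linear (inv (blinfun_apply (\<Theta> t u))) \<and>
        onorm (inv (blinfun_apply (\<Theta> t u))) \<le> B2)"

definition condition_number :: "('v::real_normed_vector \<Rightarrow>\<^sub>L 'w::real_normed_vector) \<Rightarrow> real" where
  "condition_number T = norm T * onorm (inv (blinfun_apply T))"

definition weighted_norm ::
  "('v::real_normed_vector \<Rightarrow>\<^sub>L 'w::real_normed_vector) \<Rightarrow> 'v \<Rightarrow> real" where
  "weighted_norm P v = norm (blinfun_apply P v)"

text \<open>The limit exists by convexity of the norm.\<close>

definition semi_inner :: "'a::real_normed_vector \<Rightarrow> 'a \<Rightarrow> real" where
  "semi_inner x y = norm x * Lim (at_right 0) (\<lambda>h::real. (norm (x + h *\<^sub>R y) - norm x) / h)"

text \<open>The rates are suprema in the extended reals: they may be infinite for unbounded operators, and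
  are \<^term>\<open>-\<infinity> :: ereal\<close> on a trivial space. In \<open>weighted_rate P P' D A\<close>, \<open>P\<close> is the value of the
  weight, \<open>P'\<close> that of its time derivative, and \<open>D\<close> the domain of \<open>A\<close>.\<close>

definition weighted_rate ::
  "('v::real_normed_vector \<Rightarrow>\<^sub>L 'w::real_normed_vector) \<Rightarrow> ('v \<Rightarrow>\<^sub>L 'w) \<Rightarrow> 'v set \<Rightarrow> ('v \<Rightarrow> 'v) \<Rightarrow> ereal" where
  "weighted_rate P P' D A =
     (SUP v\<in>{v \<in> D. v \<noteq> 0}.
        ereal (semi_inner (P v) (P' v + P (A v)) / (weighted_norm P v)\<^sup>2))"

definition rate :: "('w::real_normed_vector \<Rightarrow> 'w) \<Rightarrow> ereal" where
  "rate A = (SUP w\<in>{w. w \<noteq> 0}. ereal (semi_inner w (A w) / (norm w)\<^sup>2))"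

definition state_deriv ::
  "(real \<Rightarrow> 'v \<Rightarrow> 'b) \<Rightarrow> real \<Rightarrow> 'v::real_normed_vector \<Rightarrow> 'v \<Rightarrow> 'b::real_normed_vector" where
  "state_deriv F t u = frechet_derivative (\<lambda>v. F t v) (at u)"

text \<open>The derivative at \<open>t = 0\<close> is one-sided.\<close>

definition time_deriv :: "(real \<Rightarrow> 'v \<Rightarrow> 'b) \<Rightarrow> real \<Rightarrow> 'v \<Rightarrow> 'b::real_normed_vector" where
  "time_deriv F t u = vector_derivative (\<lambda>s. F s u) (at t within {0..})"

text \<open>The derivative of \<open>s \<mapsto> F s (u s)\<close> at \<open>t\<close> for a solution \<open>u\<close> of \<open>u' = f(t, u)\<close>.
  It is this time derivative of the weight, not the partial one, which governs the norm
  \<open>\<parallel>\<Theta>(t, u(t)) \<delta>u(t)\<parallel>\<close> of a tangent vector along a solution. With the partial derivative,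
  a bound on the rates of \<open>Df\<close> does not imply contraction if the weight depends on the state. The two
  derivatives agree if it does not.\<close>

definition flow_deriv ::
  "(real \<Rightarrow> 'v \<Rightarrow> 'v) \<Rightarrow> (real \<Rightarrow> 'v \<Rightarrow> 'b) \<Rightarrow> real \<Rightarrow> 'v::real_normed_vector \<Rightarrow> 'b::real_normed_vector" where
  "flow_deriv f F t u = time_deriv F t u + state_deriv F t u (f t u)"

lemma flow_deriv_eq_time_deriv:
  assumes "\<And>v w. F t v = F t w"
  shows "flow_deriv f F t u = time_deriv F t u"
proof -
  have "(\<lambda>v. F t v) = (\<lambda>v. F t 0)"
    using assms by blast
  then have "state_deriv F t u = frechet_derivative (\<lambda>v. F t 0) (at u)"
    unfolding state_deriv_def by (rule arg_cong)
  then show ?thesis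
    by (simp add: flow_deriv_def)
qed

definition solves :: "(real \<Rightarrow> 'v \<Rightarrow> 'v) \<Rightarrow> real set \<Rightarrow> (real \<Rightarrow> 'v::real_normed_vector) \<Rightarrow> bool" where
  "solves f I u \<longleftrightarrow> (\<forall>t\<in>I. (u has_vector_derivative f t (u t)) (at t within I))"

definition propagator ::
  "(real \<Rightarrow> 'v \<Rightarrow> 'v) \<Rightarrow> 'v set \<Rightarrow> (real \<Rightarrow> 'v \<Rightarrow> 'v::real_normed_vector) \<Rightarrow> bool" where
  "propagator f K \<phi> \<longleftrightarrow>
     (\<forall>u0\<in>K. \<phi> 0 u0 = u0 \<and> solves f {0..} (\<lambda>t. \<phi> t u0) \<and>
        (\<forall>u. solves f {0..} u \<and> u 0 = u0 \<longrightarrow> (\<forall>t\<ge>0. u t = \<phi> t u0)))"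

definition asymptotically_contracting_by ::
  "(real \<Rightarrow> 'v \<Rightarrow> 'v) \<Rightarrow> 'v::real_normed_vector set \<Rightarrow> (real \<Rightarrow> real) \<Rightarrow> bool" where
  "asymptotically_contracting_by f K l \<longleftrightarrow> closed K \<and> convex K \<and>
     (\<forall>t\<ge>0. 0 \<le> l t) \<and> (\<exists>c. 0 \<le> c \<and> c < 1 \<and> (l \<longlongrightarrow> c) at_top) \<and>
     (\<exists>\<phi>. propagator f K \<phi> \<and>
        (\<forall>t\<ge>0. \<forall>u0\<in>K. \<forall>v0\<in>K. norm (\<phi> t u0 - \<phi> t v0) \<le> l t * norm (u0 - v0)))"

definition asymptotic_contraction_with_rate ::
  "(real \<Rightarrow> 'v \<Rightarrow> 'v) \<Rightarrow> 'v::real_normed_vector set \<Rightarrow> real \<Rightarrow> bool" where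
  "asymptotic_contraction_with_rate f K \<rho> \<longleftrightarrow>
     (\<exists>C. asymptotically_contracting_by f K (\<lambda>t. C * exp (\<rho> * t)))"

definition growth_bound ::
  "(real \<Rightarrow> 'v \<Rightarrow> 'v) \<Rightarrow> (real \<Rightarrow> 'v \<Rightarrow> ('v::real_normed_vector \<Rightarrow>\<^sub>L 'w::real_normed_vector)) \<Rightarrow> real \<Rightarrow> bool" where
  "growth_bound f \<Theta> \<rho> \<longleftrightarrow> (\<exists>C. \<forall>u \<delta>.
     solves f {0..} u \<and> solves (\<lambda>t. state_deriv f t (u t)) {0..} \<delta> \<longrightarrow>
     (\<forall>t\<ge>0. weighted_norm (\<Theta> t (u t)) (\<delta> t)
        \<le> C * exp (\<rho> * t) * weighted_norm (\<Theta> 0 (u 0)) (\<delta> 0)))"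

end

theory Submission
  imports Defs
begin

text \<open>
  The equality of the rates is a change of variables, and the independence of the growth exponent from the weight
  is the equivalence of all the weighted norms with the norm of the state space.

  For the contraction, let \<open>u\<close> be a solution and \<open>\<delta>\<close> a tangent vector along it. The derivative from the right of
  \<open>\<parallel>\<Theta>(t, u) \<delta>\<parallel>\<close> is the directional derivative of the norm of \<open>W\<close> that occurs in the semi-inner product, so
  that the hypothesis on the rates bounds it by \<open>\<rho> \<parallel>\<Theta>(t, u) \<delta>\<parallel>\<close>. The weight enters with its derivative along the
  solution, which is why \<^const>\<open>flow_deriv\<close> and not the partial time derivative occurs in the hypothesis.
  Gronwall's inequality (\<open>norm_growth_le\<close>) shows that the weighted length of \<open>\<delta>\<close> grows at most like \<open>exp (\<rho> t)\<close>, and the bounds on the weight cost the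
  factor \<open>B1 * B2\<close>. One would integrate this along the curve into which the flow carries the segment
  between two initial values.

  Two points need care. The flow is not known to be differentiable in the initial value. Instead of tangent
  vectors, the differences of close solutions are used (\<open>close_solutions_contract\<close>): they satisfy the same
  estimate with \<open>\<rho> + e\<close> for any \<open>e > 0\<close>, and the local Lipschitz bounds that result add up along the segment.
  Neither is it known that solutions starting on the segment exist as long as those at its ends do. But since the
  solutions that exist depend on the initial value in a Lipschitz way, they converge at the first parameter
  where existence might fail (\<open>solution_from_any_point\<close>). Thus the existence of one solution on a compact time
  interval implies that of all others.

  The last fact also gives the propagator required for an asymptotic contraction. Around each instant some
  solution exists, by the Picard-Lindelof theorem, hence all do on a common interval, and the half-line is
  exhausted by such intervals (\<open>solution_exists\<close>).
\<close>

section \<open>Growth of the norm along a curve\<close>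

text \<open>Continuous induction to the right. It is used both in time, for the monotonicity of functions with a
  one-sided derivative, and along a segment of initial values. Let \<open>s\<close> be the least upper bound of the \<open>t\<close>
  such that \<open>P\<close> holds on \<open>{a..t}\<close>. Then \<open>P s\<close> by \<open>left\<close>, and \<open>s < b\<close> would contradict \<open>right\<close>.\<close>

lemma real_induction:
  fixes a b x :: real
  assumes start: "P a"
    and right: "\<And>x. a \<le> x \<Longrightarrow> x < b \<Longrightarrow> (\<And>y. a \<le> y \<Longrightarrow> y \<le> x \<Longrightarrow> P y) \<Longrightarrow>
                  \<exists>d>0. \<forall>y. x < y \<and> y < x + d \<and> y \<le> b \<longrightarrow> P y"
    and left: "\<And>x. a < x \<Longrightarrow> x \<le> b \<Longrightarrow> (\<And>y. a \<le> y \<Longrightarrow> y < x \<Longrightarrow> P y) \<Longrightarrow> P x"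
    and x: "a \<le> x" "x \<le> b"
  shows "P x"
proof -
  define S where "S = {t \<in> {a..b}. \<forall>y\<in>{a..t}. P y}"
  define s where "s = Sup S"
  have aS: "a \<in> S"
    using start x by (auto simp: S_def)
  have bdd: "bdd_above S"
    by (auto simp: S_def bdd_above_def)
  have as: "a \<le> s"
    unfolding s_def using aS bdd by (rule cSup_upper)
  have sb: "s \<le> b"
    unfolding s_def using aS by (intro cSup_least) (auto simp: S_def)
  have below: "P y" if y: "a \<le> y" "y < s" for y
  proof -
    obtain t where "t \<in> S" "y < t"
      using less_cSupE[of y S] y(2) aS unfolding s_def by blast
    then show ?thesis
      using y by (auto simp: S_def)
  qed
  then have "P s"
    using left[of s] start as sb by (cases "a = s") auto
  then have upto: "P y" if "a \<le> y" "y \<le> s" for y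
    using below that by (cases "y = s") auto
  have "s = b"
  proof (rule ccontr)
    assume "s \<noteq> b"
    then obtain d where d: "d > 0" "\<And>y. s < y \<Longrightarrow> y < s + d \<Longrightarrow> y \<le> b \<Longrightarrow> P y"
      using right[of s] as sb upto by auto
    define t where "t = min (s + d / 2) b"
    have t: "s < t" "t < s + d" "t \<le> b"
      using d \<open>s \<noteq> b\<close> sb by (auto simp: t_def)
    then have "t \<in> S"
      using as upto d by (force simp: S_def)
    then have "t \<le> s"
      unfolding s_def using bdd by (rule cSup_upper)
    with t show False
      by simp
  qed
  then show ?thesis
    using upto x by simp
qed

text \<open>The norm of a smooth curve is in general differentiable from the right only, so that the mean value theorem is not
  available. Continuous induction gives \<open>n t \<le> n a + c * (t - a)\<close> for each slope \<open>c > 0\<close>: the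
  strict inequality leaves the room needed to step to the right.\<close>

lemma nonpos_right_derivative_imp_le:
  fixes n :: "real \<Rightarrow> real"
  assumes ab: "a \<le> b" and cont: "continuous_on {a..b} n"
    and der: "\<And>t. a \<le> t \<Longrightarrow> t < b \<Longrightarrow> \<exists>D\<le>0. (n has_real_derivative D) (at_right t)"
  shows "n b \<le> n a"
proof -
  have "n b \<le> n a + c * (b - a)" if c: "c > 0" for c
  proof -
    define P where "P = (\<lambda>t. n t \<le> n a + c * (t - a))"
    have "P b"
    proof (rule real_induction[where a = a and b = b])
      show "P a" by (simp add: P_def)
    next
      fix t assume t: "a \<le> t" "t < b" and *: "\<And>y. a \<le> y \<Longrightarrow> y \<le> t \<Longrightarrow> P y"
      obtain D where D: "D \<le> 0" "(n has_real_derivative D) (at_right t)"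
        using der[OF t] by auto
      then have "((\<lambda>y. (n y - n t) / (y - t)) \<longlongrightarrow> D) (at_right t)"
        by (simp add: has_field_derivative_iff)
      then have "\<forall>\<^sub>F y in at_right t. (n y - n t) / (y - t) < c"
        by (rule order_tendstoD(2)) (use c D(1) in simp)
      then obtain e where e: "e > t" "\<And>y. t < y \<Longrightarrow> y < e \<Longrightarrow> (n y - n t) / (y - t) < c"
        by (auto simp: eventually_at_right_field)
      have "P y" if "t < y" "y < e" for y
      proof -
        have "n y - n t < c * (y - t)"
          using e(2)[OF that] that by (simp add: field_simps)
        moreover have "n t \<le> n a + c * (t - a)"
          using *[of t] t by (simp add: P_def)
        ultimately show ?thesis
          by (simp add: P_def algebra_simps)
      qed
      then show "\<exists>d>0. \<forall>y. t < y \<and> y < t + d \<and> y \<le> b \<longrightarrow> P y"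
        using e(1) by (intro exI[of _ "e - t"]) auto
    next
      fix t assume t: "a < t" "t \<le> b" and *: "\<And>y. a \<le> y \<Longrightarrow> y < t \<Longrightarrow> P y"
      have "(n \<longlongrightarrow> n t) (at t within {a..t})"
        by (rule tendsto_within_subset[of _ _ _ "{a..b}"]) (use cont t in \<open>auto simp: continuous_on\<close>)
      then have lim: "(n \<longlongrightarrow> n t) (at_left t)"
        by (simp only: at_within_Icc_at_left[OF t(1)])
      show "P t"
        unfolding P_def
      proof (rule tendsto_le[OF _ _ lim])
        show "((\<lambda>y. n a + c * (y - a)) \<longlongrightarrow> n a + c * (t - a)) (at_left t)"
          by (intro tendsto_intros)
        show "\<forall>\<^sub>F y in at_left t. n y \<le> n a + c * (y - a)"
          using * t by (auto simp: eventually_at_left_field P_def intro!: exI[of _ a])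
      qed simp
    qed (use ab in auto)
    then show ?thesis
      by (simp add: P_def)
  qed
  then have "n b \<le> n a + e" if "e > 0" for e
  proof (cases "a = b")
    case False
    then show ?thesis
      using \<open>\<And>c. c > 0 \<Longrightarrow> n b \<le> n a + c * (b - a)\<close>[of "e / (b - a)"] that ab by simp
  qed (use that in simp)
  then show ?thesis
    by (rule field_le_epsilon)
qed

text \<open>The directional derivative from the right of the norm at \<open>x\<close>; it is the limit in the semi-inner
  product without the factor \<open>\<parallel>x\<parallel>\<close>, so that it is also informative at \<open>x = 0\<close>.\<close>

definition norm_dir :: "'a::real_normed_vector \<Rightarrow> 'a \<Rightarrow> real" where
  "norm_dir x y = Lim (at_right 0) (\<lambda>h. (norm (x + h *\<^sub>R y) - norm x) / h)"

text \<open>The limit exists because the difference quotients of the convex function \<open>h \<mapsto> \<parallel>x + h y\<parallel>\<close> decrease as \<open>h\<close>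
  decreases to 0, and are bounded below by \<open>- \<parallel>y\<parallel>\<close>.\<close>

lemma tendsto_norm_dir:
  "((\<lambda>h. (norm (x + h *\<^sub>R y) - norm x) / h) \<longlongrightarrow> norm_dir x y) (at_right 0)"
proof -
  define q where "q = (\<lambda>h. (norm (x + h *\<^sub>R y) - norm x) / h)"
  have mono: "q h \<le> q k" if "0 < h" "h \<le> k" for h k
  proof -
    have "x + h *\<^sub>R y = (1 - h / k) *\<^sub>R x + (h / k) *\<^sub>R (x + k *\<^sub>R y)"
      using that by (simp add: algebra_simps)
    then have "norm (x + h *\<^sub>R y) \<le> (1 - h / k) * norm x + (h / k) * norm (x + k *\<^sub>R y)"
      using that norm_triangle_ineq[of "(1 - h / k) *\<^sub>R x" "(h / k) *\<^sub>R (x + k *\<^sub>R y)"] by simp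
    then have "norm (x + h *\<^sub>R y) - norm x \<le> h * q k"
      using that by (simp add: q_def field_simps)
    then show ?thesis
      using that by (simp add: q_def divide_le_eq mult.commute)
  qed
  have low: "- norm y \<le> q h" if "0 < h" for h
  proof -
    have "norm x \<le> norm (x + h *\<^sub>R y) + h * norm y"
      using norm_triangle_ineq4[of "x + h *\<^sub>R y" "h *\<^sub>R y"] that by simp
    then show ?thesis
      using that by (simp add: q_def field_simps)
  qed
  have "(q \<longlongrightarrow> Inf (q ` ({0<..} \<inter> UNIV))) (at 0 within ({0<..} \<inter> UNIV))"
    using mono low by (intro Lim_right_bound) auto
  then have "(q \<longlongrightarrow> Lim (at_right 0) q) (at_right 0)"
    using tendsto_Lim[of "at_right 0" q] by simp
  then show ?thesis
    by (simp add: norm_dir_def q_def)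
qed

lemma semi_inner_eq: "semi_inner x y = norm x * norm_dir x y"
  by (simp add: semi_inner_def norm_dir_def)

lemma norm_dir_zero [simp]: "norm_dir x 0 = 0"
  by (simp add: norm_dir_def tendsto_Lim)

lemma norm_dir_add_le: "norm_dir x (y + z) \<le> norm_dir x y + norm z"
proof (rule tendsto_le[OF _ tendsto_add[OF tendsto_norm_dir tendsto_const] tendsto_norm_dir])
  have "(norm (x + h *\<^sub>R (y + z)) - norm x) / h \<le> (norm (x + h *\<^sub>R y) - norm x) / h + norm z"
    if "h > 0" for h
  proof -
    have "norm (x + h *\<^sub>R (y + z)) \<le> norm (x + h *\<^sub>R y) + h * norm z"
      using norm_triangle_ineq[of "x + h *\<^sub>R y" "h *\<^sub>R z"] that by (simp add: algebra_simps)
    then show ?thesis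
      using that by (simp add: field_simps)
  qed
  then show "\<forall>\<^sub>F h in at_right 0. (norm (x + h *\<^sub>R (y + z)) - norm x) / h
      \<le> (norm (x + h *\<^sub>R y) - norm x) / h + norm z"
    by (auto simp: eventually_at_right_field intro: exI[of _ 1])
qed simp

text \<open>The curve and its tangent line differ by \<open>o(s - t)\<close>, and so do their norms.\<close>

lemma norm_has_right_derivative:
  assumes "(y has_vector_derivative z) (at_right t)"
  shows "((\<lambda>s. norm (y s)) has_real_derivative norm_dir (y t) z) (at_right t)"
proof -
  have "filterlim (\<lambda>s. s - t) (at_right 0) (at_right t)"
    by (auto simp: filterlim_at eventually_at_filter intro!: tendsto_eq_intros)
  from filterlim_compose[OF tendsto_norm_dir[of "y t" z] this]
  have 1: "((\<lambda>s. (norm (y t + (s - t) *\<^sub>R z) - norm (y t)) / (s - t)) \<longlongrightarrow> norm_dir (y t) z) (at_right t)"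
    by simp
  have 2: "((\<lambda>s. norm (y s - y t - (s - t) *\<^sub>R z) / norm (s - t)) \<longlongrightarrow> 0) (at_right t)"
    using assms by (simp add: has_vector_derivative_def has_derivative_iff_norm)
  have 3: "((\<lambda>s. (norm (y s) - norm (y t)) / (s - t)
      - (norm (y t + (s - t) *\<^sub>R z) - norm (y t)) / (s - t)) \<longlongrightarrow> 0) (at_right t)"
  proof (rule Lim_null_comparison[OF _ 2])
    have "norm ((norm (y s) - norm (y t)) / (s - t) - (norm (y t + (s - t) *\<^sub>R z) - norm (y t)) / (s - t))
        \<le> norm (y s - y t - (s - t) *\<^sub>R z) / norm (s - t)" if "t < s" for s
      using norm_triangle_ineq3[of "y s" "y t + (s - t) *\<^sub>R z"] that
      by (simp add: divide_right_mono diff_diff_eq flip: diff_divide_distrib)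
    then show "\<forall>\<^sub>F s in at_right t. norm ((norm (y s) - norm (y t)) / (s - t)
        - (norm (y t + (s - t) *\<^sub>R z) - norm (y t)) / (s - t))
        \<le> norm (y s - y t - (s - t) *\<^sub>R z) / norm (s - t)"
      by (auto simp: eventually_at_filter)
  qed
  from tendsto_add[OF 3 1] show ?thesis
    by (simp add: has_field_derivative_iff)
qed

text \<open>A form of Gronwall's inequality: \<open>t \<mapsto> exp (- \<kappa> t) \<parallel>y t\<parallel>\<close> has a nonpositive derivative from the right.
  This is how a bound on the rate becomes a bound on the growth of a norm.\<close>

lemma norm_growth_le:
  assumes ab: "a \<le> b"
    and der: "\<And>t. t \<in> {a..b} \<Longrightarrow> (y has_vector_derivative z t) (at t within {a..b})"
    and le: "\<And>t. t \<in> {a..b} \<Longrightarrow> norm_dir (y t) (z t) \<le> \<kappa> * norm (y t)"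
  shows "norm (y b) \<le> exp (\<kappa> * (b - a)) * norm (y a)"
proof -
  define n where "n t = exp (- (\<kappa> * t)) * norm (y t)" for t
  have "n b \<le> n a"
  proof (rule nonpos_right_derivative_imp_le[OF ab])
    have "continuous_on {a..b} y"
      using der by (meson continuous_on_eq_continuous_within has_vector_derivative_continuous)
    then show "continuous_on {a..b} n"
      unfolding n_def by (intro continuous_intros)
  next
    fix t assume t: "a \<le> t" "t < b"
    have "(y has_vector_derivative z t) (at t within {t..b})"
      using der[of t] t by (auto intro: has_vector_derivative_within_subset)
    then have "(y has_vector_derivative z t) (at_right t)"
      by (simp only: at_within_Icc_at_right[OF t(2)])
    from norm_has_right_derivative[OF this]
    have "(n has_real_derivative exp (- (\<kappa> * t)) * (norm_dir (y t) (z t) - \<kappa> * norm (y t))) (at_right t)"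
      unfolding n_def by (auto intro!: derivative_eq_intros simp: algebra_simps)
    moreover have "exp (- (\<kappa> * t)) * (norm_dir (y t) (z t) - \<kappa> * norm (y t)) \<le> 0"
      using le[of t] t by (simp add: mult_nonneg_nonpos)
    ultimately show "\<exists>D\<le>0. (n has_real_derivative D) (at_right t)"
      by blast
  qed
  then have "exp (\<kappa> * b) * n b \<le> exp (\<kappa> * b) * n a"
    by simp
  then show ?thesis
    by (simp add: n_def mult.assoc[symmetric] flip: exp_add) (simp add: algebra_simps)
qed

section \<open>Continuously differentiable families\<close>

text \<open>In infinite dimensions the trajectory of a solution is compact, but no neighbourhood of it is. Uniform
  continuity holds nevertheless when one of the two points is kept on the compact set, and this is all that
  estimates near a given trajectory need.\<close>

lemma continuous_on_near_compact:
  fixes F :: "'a::metric_space \<Rightarrow> 'b::metric_space"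
  assumes cont: "continuous_on S F" and K: "compact K" "K \<subseteq> S" and e: "e > 0"
  obtains d where "d > 0" "\<And>x y. x \<in> K \<Longrightarrow> y \<in> S \<Longrightarrow> dist y x < d \<Longrightarrow> dist (F y) (F x) < e"
proof -
  define \<G> where "\<G> = {ball k d |k d. k \<in> K \<and> (\<forall>y\<in>S \<inter> ball k d. dist (F y) (F k) < e / 2)}"
  have "K \<subseteq> \<Union>\<G>"
  proof
    fix k assume k: "k \<in> K"
    then obtain d where d: "d > 0" "\<And>y. y \<in> S \<Longrightarrow> dist y k < d \<Longrightarrow> dist (F y) (F k) < e / 2"
      using continuous_on_iff[THEN iffD1, rule_format, OF cont, of k "e / 2"] K(2) e by auto
    then have "ball k d \<in> \<G>"
      using k unfolding \<G>_def
      by (intro CollectI exI[of _ k] exI[of _ d] conjI refl) (auto simp: dist_commute[of k])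
    then show "k \<in> \<Union>\<G>"
      by (rule UnionI) (use d(1) in simp)
  qed
  moreover have "open G" if "G \<in> \<G>" for G
    using that by (auto simp: \<G>_def)
  ultimately obtain d where d: "d > 0" "\<And>x. x \<in> K \<Longrightarrow> \<exists>G\<in>\<G>. ball x d \<subseteq> G"
    using Heine_Borel_lemma[OF K(1)] by metis
  show ?thesis
  proof (rule that[OF d(1)])
    fix x y assume xy: "x \<in> K" "y \<in> S" "dist y x < d"
    then obtain k r where k: "ball x d \<subseteq> ball k r" "\<forall>y\<in>S \<inter> ball k r. dist (F y) (F k) < e / 2"
      using d(2)[of x] by (auto simp: \<G>_def)
    have "x \<in> ball x d" "y \<in> ball x d"
      using xy d(1) by (auto simp: dist_commute)
    then have "x \<in> S \<inter> ball k r" "y \<in> S \<inter> ball k r"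
      using xy(1,2) K(2) k(1) by blast+
    then have "dist (F x) (F k) < e / 2" "dist (F y) (F k) < e / 2"
      using k(2) by blast+
    then show "dist (F y) (F x) < e"
      using dist_triangle_half_l by blast
  qed
qed

lemma C1_on_state_deriv:
  fixes F :: "real \<Rightarrow> 'v::real_normed_vector \<Rightarrow> 'b::real_normed_vector"
  assumes "C1_on ({0..} \<times> UNIV) (\<lambda>(t, u). F t u)"
  obtains D where "continuous_on ({0..} \<times> UNIV) (\<lambda>(t, u). D t u)"
    and "\<And>t u. 0 \<le> t \<Longrightarrow> (F t has_derivative blinfun_apply (D t u)) (at u)"
    and "\<And>t u. 0 \<le> t \<Longrightarrow> state_deriv F t u = blinfun_apply (D t u)"
proof -
  obtain F' where F': "\<And>x. x \<in> {0..} \<times> UNIV \<Longrightarrow>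
      ((\<lambda>(t, u). F t u) has_derivative blinfun_apply (F' x)) (at x within {0..} \<times> UNIV)"
    and cont: "continuous_on ({0..} \<times> UNIV) F'"
    using assms unfolding C1_on_def by blast
  define i :: "'v \<Rightarrow>\<^sub>L (real \<times> 'v)" where "i = Blinfun (Pair 0)"
  have i: "blinfun_apply i = Pair 0"
    unfolding i_def by (rule bounded_linear_Blinfun_apply) (intro bounded_linear_intros)
  define D where "D t u = F' (t, u) o\<^sub>L i" for t u
  have der: "(F t has_derivative blinfun_apply (D t u)) (at u)" if "0 \<le> t" for t u
  proof -
    have "((\<lambda>v. (\<lambda>(t, u). F t u) (t, v)) has_derivative (\<lambda>h. blinfun_apply (F' (t, u)) (0, h))) (at u)"
      using that
      by (intro has_derivative_in_compose2[of "{0..} \<times> UNIV" "\<lambda>(t, u). F t u" "\<lambda>x. blinfun_apply (F' x)"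
            "Pair t"  UNIV] F') (auto intro!: derivative_eq_intros)
    moreover have "blinfun_apply (D t u) = (\<lambda>h. blinfun_apply (F' (t, u)) (0, h))"
      by (auto simp: D_def i)
    ultimately show ?thesis
      by simp
  qed
  show ?thesis
  proof
    show "continuous_on ({0..} \<times> UNIV) (\<lambda>(t, u). D t u)"
      using cont by (auto simp: D_def case_prod_unfold intro!: continuous_intros)
    show "state_deriv F t u = blinfun_apply (D t u)" if "0 \<le> t" for t u
      using frechet_derivative_at[OF der[OF that]] by (simp add: state_deriv_def)
  qed (rule der)
qed

lemma C1_on_continuous:
  assumes "C1_on S F"
  shows "continuous_on S F"
  using assms unfolding C1_on_def
  by (meson continuous_on_eq_continuous_within has_derivative_continuous)

text \<open>The joint derivative at \<open>(t, u t)\<close> is applied to the velocity \<open>(1, f t (u t))\<close> of the trajectory in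
  space-time. At \<open>t = 0\<close> only the one-sided time derivative exists; it determines \<^const>\<open>time_deriv\<close> because 0
  is a limit point of \<open>{0..}\<close>.\<close>

lemma C1_on_derivative_along_solution:
  assumes C1: "C1_on ({0..} \<times> UNIV) (\<lambda>(t, u). F t u)"
    and u: "solves f I u" and I: "I \<subseteq> {0..}" and t: "t \<in> I"
  shows "((\<lambda>s. F s (u s)) has_vector_derivative flow_deriv f F t (u t)) (at t within I)"
proof -
  obtain F' where F': "\<And>x. x \<in> {0..} \<times> UNIV \<Longrightarrow>
      ((\<lambda>(t, u). F t u) has_derivative blinfun_apply (F' x)) (at x within {0..} \<times> UNIV)"
    using C1 unfolding C1_on_def by blast
  define L where "L = F' (t, u t)"
  have t0: "0 \<le> t"
    using t I by auto
  have ut: "(u has_vector_derivative f t (u t)) (at t within I)"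
    using u t by (auto simp: solves_def)
  have Lt: "(\<lambda>h. blinfun_apply L (h, 0)) = (\<lambda>h. h *\<^sub>R blinfun_apply L (1, 0))"
    by (simp only: blinfun.scaleR_right[symmetric] scaleR_Pair real_scaleR_def mult_1_right scaleR_zero_right)
  have Lh: "blinfun_apply L (h, h *\<^sub>R v) = h *\<^sub>R (L (1, 0) + L (0, v))" for h v
    by (simp only: blinfun.scaleR_right[symmetric] blinfun.add_right[symmetric] scaleR_Pair add_Pair
        real_scaleR_def mult_1_right add_0_left add_0_right)
  have "((\<lambda>s. (\<lambda>(t, u). F t u) (s, u t)) has_derivative (\<lambda>h. blinfun_apply L (h, 0)))
      (at t within {0..})"
    unfolding L_def using t0 by (intro has_derivative_in_compose2[of "{0..} \<times> UNIV" "\<lambda>(t, u). F t u"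
          "\<lambda>x. blinfun_apply (F' x)" "\<lambda>s. (s, u t)"] F') (auto intro!: derivative_eq_intros)
  then have "((\<lambda>s. F s (u t)) has_vector_derivative L (1, 0)) (at t within {0..})"
    unfolding Lt has_vector_derivative_def by simp
  then have T: "time_deriv F t (u t) = L (1, 0)"
    unfolding time_deriv_def
  proof (rule vector_derivative_within[rotated])
    have "at_right t \<le> at t within {0..}"
      using t0 by (intro at_le) auto
    then show "at t within {0..} \<noteq> bot"
      using trivial_limit_at_right_real[of t] by (metis le_bot)
  qed
  have "((\<lambda>v. (\<lambda>(t, u). F t u) (t, v)) has_derivative (\<lambda>h. blinfun_apply L (0, h))) (at (u t))"
    unfolding L_def using t0
    by (intro has_derivative_in_compose2[of "{0..} \<times> UNIV" "\<lambda>(t, u). F t u" "\<lambda>x. blinfun_apply (F' x)"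
          "Pair t" UNIV] F') (auto intro!: derivative_eq_intros)
  from frechet_derivative_at[OF this] have S: "state_deriv F t (u t) = (\<lambda>h. L (0, h))"
    by (simp add: state_deriv_def)
  have "((\<lambda>s. (\<lambda>(t, u). F t u) (s, u s)) has_derivative (\<lambda>h. blinfun_apply L (h, h *\<^sub>R f t (u t))))
      (at t within I)"
    unfolding L_def using t I ut
    by (intro has_derivative_in_compose2[of "{0..} \<times> UNIV" "\<lambda>(t, u). F t u"
          "\<lambda>x. blinfun_apply (F' x)" "\<lambda>s. (s, u s)"] F')
      (auto simp: has_vector_derivative_def intro!: has_derivative_Pair)
  then show ?thesis
    by (simp only: Lh has_vector_derivative_def flow_deriv_def T S prod.case)
qed

section \<open>Solutions on intervals\<close>

lemma solves_subset: "solves f I u \<Longrightarrow> J \<subseteq> I \<Longrightarrow> solves f J u"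
  unfolding solves_def by (auto intro: has_vector_derivative_within_subset)

lemma solves_continuous_on: "solves f I u \<Longrightarrow> continuous_on I u"
  unfolding solves_def continuous_on_eq_continuous_within
  by (meson has_vector_derivative_continuous)

lemma solves_cong:
  assumes u: "solves f I u" and eq: "\<And>t. t \<in> I \<Longrightarrow> u t = v t"
  shows "solves f I v"
  unfolding solves_def
proof
  fix t assume t: "t \<in> I"
  have "(v has_vector_derivative f t (u t)) (at t within I)"
    by (rule has_vector_derivative_transform[OF t, of v u]) (use u t eq in \<open>auto simp: solves_def\<close>)
  then show "(v has_vector_derivative f t (v t)) (at t within I)"
    using eq[OF t] by simp
qed

lemma solves_concat:
  assumes u: "solves f {a..b} u" and v: "solves f {b..c} v" and eq: "u b = v b"
    and ab: "a \<le> b" and bc: "b \<le> c"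
  shows "solves f {a..c} (\<lambda>t. if t \<le> b then u t else v t)"
  unfolding solves_def
proof
  fix t assume t: "t \<in> {a..c}"
  define w where "w = (\<lambda>t. if t \<in> {a..b} then u t else v t)"
  have "(w has_vector_derivative (if t \<in> {a..b} then f t (u t) else f t (v t)))
      (at t within {a..c})"
    unfolding w_def
  proof (rule has_vector_derivative_If_within_closures[where T = "{b..c}"])
    show "t \<in> {a..b} \<union> {b..c}" "{a..c} = {a..b} \<union> {b..c}"
      using t ab bc by auto
  qed (use u v eq ab bc in \<open>auto simp: solves_def insert_absorb Int_absorb1 dest: antisym\<close>)
  also have "(if t \<in> {a..b} then f t (u t) else f t (v t)) = f t (if t \<le> b then u t else v t)"
    using t by auto
  finally have "(w has_vector_derivative f t (if t \<le> b then u t else v t)) (at t within {a..c})" .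
  then show "((\<lambda>t. if t \<le> b then u t else v t) has_vector_derivative
      f t (if t \<le> b then u t else v t)) (at t within {a..c})"
    by (rule has_vector_derivative_transform[rotated 2]) (use t in \<open>auto simp: w_def\<close>)
qed

lemma compact_graph:
  fixes u :: "real \<Rightarrow> 'v::real_normed_vector"
  assumes "continuous_on {a..b} u"
  shows "compact ((\<lambda>t. (t, u t)) ` {a..b})"
  using assms by (intro compact_continuous_image continuous_intros) auto

text \<open>The velocities \<open>f t (w n t)\<close> converge uniformly as well, because the graph of the limit is compact.\<close>

lemma solves_limit:
  fixes w :: "nat \<Rightarrow> real \<Rightarrow> 'v::banach"
  assumes f: "continuous_on ({0..} \<times> UNIV) (\<lambda>(t, u). f t u)" and a: "0 \<le> a"
    and w: "\<And>n. solves f {a..b} (w n)"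
    and lim: "uniform_limit {a..b} w v sequentially"
  shows "solves f {a..b} v"
proof (cases "a \<le> b")
  case ab: True
  have cv: "continuous_on {a..b} v"
    using solves_continuous_on[OF w] by (intro uniform_limit_theorem[OF _ lim] always_eventually) auto
  have vt: "(\<lambda>n. w n t) \<longlonglongrightarrow> v t" if "t \<in> {a..b}" for t
    using tendsto_uniform_limitI[OF lim that] .
  have nle: "\<forall>\<^sub>F n in sequentially. \<forall>t\<in>{a..b}. \<forall>h. norm (h *\<^sub>R f t (w n t) - h *\<^sub>R f t (v t)) \<le> e * norm h"
    if e: "e > 0" for e
  proof -
    obtain d where d: "d > 0" "\<And>x y. x \<in> (\<lambda>t. (t, v t)) ` {a..b} \<Longrightarrow> y \<in> {0..} \<times> UNIV \<Longrightarrow> dist y x < d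
        \<Longrightarrow> dist ((\<lambda>(t, u). f t u) y) ((\<lambda>(t, u). f t u) x) < e"
      by (rule continuous_on_near_compact[OF f compact_graph[OF cv] _ e]) (use a in auto)
    have "\<forall>\<^sub>F n in sequentially. \<forall>t\<in>{a..b}. dist (w n t) (v t) < d"
      using lim d(1) by (rule uniform_limitD)
    then show ?thesis
    proof eventually_elim
      case (elim n)
      have "norm (h *\<^sub>R f t (w n t) - h *\<^sub>R f t (v t)) \<le> e * norm h" if t: "t \<in> {a..b}" for t h
      proof -
        have "norm (f t (w n t) - f t (v t)) < e"
          using d(2)[of "(t, v t)" "(t, w n t)"] elim t a by (auto simp: dist_Pair_Pair dist_norm)
        then have "norm h * norm (f t (w n t) - f t (v t)) \<le> norm h * e"
          by (intro mult_left_mono) auto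
        then show ?thesis
          by (simp add: mult.commute flip: scaleR_diff_right)
      qed
      then show ?case
        by blast
    qed
  qed
  have "\<exists>g. \<forall>t\<in>{a..b}. (\<lambda>n. w n t) \<longlonglongrightarrow> g t
      \<and> (g has_derivative (\<lambda>h. h *\<^sub>R f t (v t))) (at t within {a..b})"
  proof (rule has_derivative_sequence[OF _ _ nle])
    show "(w n has_derivative (\<lambda>h. h *\<^sub>R f t (w n t))) (at t within {a..b})"
      if "t \<in> {a..b}" for n t
      using w that by (simp add: solves_def has_vector_derivative_def)
    show "(\<lambda>n. w n a) \<longlonglongrightarrow> v a"
      using vt ab by simp
  qed (use ab in auto)
  then obtain g where g: "\<And>t. t \<in> {a..b} \<Longrightarrow> (\<lambda>n. w n t) \<longlonglongrightarrow> g t"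
    "\<And>t. t \<in> {a..b} \<Longrightarrow> (g has_vector_derivative f t (v t)) (at t within {a..b})"
    unfolding has_vector_derivative_def by blast
  have gv: "g t = v t" if "t \<in> {a..b}" for t
    using LIMSEQ_unique[OF g(1)[OF that] vt[OF that]] .
  have "(v has_vector_derivative f t (v t)) (at t within {a..b})" if t: "t \<in> {a..b}" for t
    by (rule has_vector_derivative_transform[OF t _ g(2)[OF t]]) (simp add: gv)
  then show ?thesis
    by (simp add: solves_def)
qed (simp add: solves_def)

text \<open>The Picard-Lindelof theorem for a possibly interior initial time \<open>t0\<close>. The Picard operator acts on
  bounded continuous functions on the whole line: its values outside \<open>{a..b}\<close> are the boundary values, hence
  the use of \<^const>\<open>clamp\<close>. The interior initial time matters for global existence, where a solution is sought
  on both sides of a given instant.\<close>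

lemma lipschitz_solution_exists:
  fixes g :: "real \<Rightarrow> 'v::banach \<Rightarrow> 'v"
  assumes cont: "continuous_on ({a..b} \<times> cball p s) (\<lambda>(t, u). g t u)"
    and bound: "\<And>t u. t \<in> {a..b} \<Longrightarrow> u \<in> cball p s \<Longrightarrow> norm (g t u) \<le> M"
    and lip: "\<And>t u v. t \<in> {a..b} \<Longrightarrow> u \<in> cball p s \<Longrightarrow> v \<in> cball p s \<Longrightarrow>
                norm (g t u - g t v) \<le> L * norm (u - v)"
    and t0: "t0 \<in> {a..b}" and s: "norm (q - p) + M * (b - a) \<le> s"
    and M: "0 \<le> M" and L: "0 \<le> L" "L * (b - a) < 1"
  obtains w where "solves g {a..b} w" "w t0 = q" "\<And>t. t \<in> {a..b} \<Longrightarrow> w t \<in> cball p s"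
proof -
  define S where "S = PiC (UNIV :: real set) (\<lambda>_. cball p s)"
  \<comment> \<open>A difference of integrals from \<open>a\<close>, as \<open>t\<close> may lie on either side of \<open>t0\<close>.\<close>
  define G where "G \<phi> t = q + (integral {a..t} (\<lambda>\<tau>. g \<tau> (apply_bcontfun \<phi> \<tau>))
      - integral {a..t0} (\<lambda>\<tau>. g \<tau> (apply_bcontfun \<phi> \<tau>)))" for \<phi> :: "real \<Rightarrow>\<^sub>C 'v" and t
  have ab: "a \<le> b"
    using t0 by simp
  then have "0 \<le> norm (q - p) + M * (b - a)"
    using M by simp
  then have s0: "0 \<le> s"
    using s by (rule order_trans)
  have inS: "apply_bcontfun \<phi> t \<in> cball p s" if "\<phi> \<in> S" for \<phi> t
    using that by (auto simp: S_def mem_PiC_iff)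
  have der: "(G \<phi> has_vector_derivative g t (apply_bcontfun \<phi> t)) (at t within {a..b})"
    if "\<phi> \<in> S" "t \<in> {a..b}" for \<phi> t
  proof -
    have "continuous_on {a..b} (\<lambda>\<tau>. (\<lambda>(t, u). g t u) (\<tau>, apply_bcontfun \<phi> \<tau>))"
      by (rule continuous_on_compose2[OF cont]) (use inS[OF that(1)] in \<open>auto intro!: continuous_intros\<close>)
    then have "continuous_on {a..b} (\<lambda>\<tau>. g \<tau> (apply_bcontfun \<phi> \<tau>))"
      by simp
    from integral_has_vector_derivative[OF this that(2)] show ?thesis
      unfolding G_def by (auto intro!: derivative_eq_intros)
  qed
  have dist_t0: "\<bar>t - t0\<bar> \<le> b - a" if "t \<in> {a..b}" for t
    using that t0 by auto
  have Gt0: "G \<phi> t0 = q" for \<phi>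
    by (simp add: G_def)
  have ball: "G \<phi> t \<in> cball p s" if \<phi>: "\<phi> \<in> S" and t: "t \<in> {a..b}" for \<phi> t
  proof -
    have "norm (G \<phi> t - G \<phi> t0) \<le> M * norm (t - t0)"
      using bound inS[OF \<phi>] M
      by (intro differentiable_bound[where S = "{a..b}" and f' = "\<lambda>t h. h *\<^sub>R g t (apply_bcontfun \<phi> t)"]
          onorm_bound)
        (use der[OF \<phi>] t t0 in \<open>auto simp: has_vector_derivative_def mult.commute[of M] intro!: mult_left_mono\<close>)
    also have "\<dots> \<le> M * (b - a)"
      using dist_t0[OF t] M by (intro mult_left_mono) auto
    finally show ?thesis
      using norm_triangle_ineq[of "q - p" "G \<phi> t - q"] s
      by (simp add: Gt0 dist_norm norm_minus_commute)
  qed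
  have lipG: "norm (G \<phi> t - G \<psi> t) \<le> L * (b - a) * dist \<phi> \<psi>"
    if \<phi>: "\<phi> \<in> S" and \<psi>: "\<psi> \<in> S" and t: "t \<in> {a..b}" for \<phi> \<psi> t
  proof -
    have bd: "norm (g t (apply_bcontfun \<phi> t) - g t (apply_bcontfun \<psi> t)) \<le> L * dist \<phi> \<psi>"
      if "t \<in> {a..b}" for t
    proof -
      have "norm (g t (apply_bcontfun \<phi> t) - g t (apply_bcontfun \<psi> t))
          \<le> L * norm (apply_bcontfun \<phi> t - apply_bcontfun \<psi> t)"
        by (rule lip[OF that inS[OF \<phi>] inS[OF \<psi>]])
      also have "\<dots> \<le> L * dist \<phi> \<psi>"
        using dist_bounded[of \<phi> t \<psi>] L by (intro mult_left_mono) (auto simp: dist_norm)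
      finally show ?thesis .
    qed
    have "norm ((G \<phi> t - G \<psi> t) - (G \<phi> t0 - G \<psi> t0)) \<le> (L * dist \<phi> \<psi>) * norm (t - t0)"
    proof (rule differentiable_bound[where S = "{a..b}" and
        f' = "\<lambda>t h. h *\<^sub>R (g t (apply_bcontfun \<phi> t) - g t (apply_bcontfun \<psi> t))"])
      show "((\<lambda>t. G \<phi> t - G \<psi> t) has_derivative
          (\<lambda>h. h *\<^sub>R (g t (apply_bcontfun \<phi> t) - g t (apply_bcontfun \<psi> t)))) (at t within {a..b})"
        if "t \<in> {a..b}" for t
        using has_vector_derivative_diff[OF der[OF \<phi> that] der[OF \<psi> that]]
        by (simp add: has_vector_derivative_def)
      show "onorm (\<lambda>h. h *\<^sub>R (g t (apply_bcontfun \<phi> t) - g t (apply_bcontfun \<psi> t))) \<le> L * dist \<phi> \<psi>"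
        if "t \<in> {a..b}" for t
        using bd[OF that] L
        by (intro onorm_bound) (auto simp: mult.commute intro!: mult_left_mono)
    qed (use t t0 in auto)
    also have "\<dots> \<le> (L * dist \<phi> \<psi>) * (b - a)"
      using dist_t0[OF t] L by (intro mult_left_mono) auto
    finally show ?thesis
      by (simp add: Gt0 mult_ac)
  qed
  have "\<exists>\<psi>. (\<forall>t\<in>{a..b}. apply_bcontfun \<psi> t = G \<phi> t) \<and> (\<forall>t. apply_bcontfun \<psi> t = G \<phi> (clamp a b t))"
    if "\<phi> \<in> S" for \<phi>
  proof -
    have "continuous_on (cbox a b) (G \<phi>)"
      using has_vector_derivative_continuous[OF der[OF that]]
      by (simp add: continuous_on_eq_continuous_within)
    then obtain \<psi> :: "real \<Rightarrow>\<^sub>C 'v" where "\<And>t. t \<in> cbox a b \<Longrightarrow> apply_bcontfun \<psi> t = G \<phi> t"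
      "\<And>t. apply_bcontfun \<psi> t = G \<phi> (clamp a b t)"
      by (rule continuous_on_cbox_bcontfunE) blast
    then show ?thesis
      unfolding box_real by blast
  qed
  then obtain P where P: "\<And>\<phi> t. \<phi> \<in> S \<Longrightarrow> t \<in> {a..b} \<Longrightarrow> apply_bcontfun (P \<phi>) t = G \<phi> t"
    "\<And>\<phi> t. \<phi> \<in> S \<Longrightarrow> apply_bcontfun (P \<phi>) t = G \<phi> (clamp a b t)"
    by metis
  have cl: "clamp a b t \<in> {a..b}" for t
    using ab clamp_in_interval[of a b t] by auto
  have "\<exists>!\<phi>\<in>S. P \<phi> = \<phi>"
  proof (rule Banach_fix)
    show "complete S"
      unfolding S_def complete_eq_closed by (rule closed_PiC) simp
    have "const_bcontfun p \<in> S"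
      using s0 by (auto simp: S_def mem_PiC_iff)
    then show "S \<noteq> {}"
      by blast
    show "P ` S \<subseteq> S"
      using P(2) ball cl by (auto simp: S_def[symmetric] mem_PiC_iff) (auto simp: S_def mem_PiC_iff)
    show "dist (P \<phi>) (P \<psi>) \<le> (L * (b - a)) * dist \<phi> \<psi>" if "\<phi> \<in> S" "\<psi> \<in> S" for \<phi> \<psi>
      using P(2) lipG[OF that cl] that by (intro dist_bound) (simp add: dist_norm)
  qed (use L ab in auto)
  then obtain \<phi> where \<phi>: "\<phi> \<in> S" "P \<phi> = \<phi>"
    by blast
  have eq: "apply_bcontfun \<phi> t = G \<phi> t" if "t \<in> {a..b}" for t
    using P(1)[OF \<phi>(1) that] \<phi>(2) by simp
  show ?thesis
  proof (rule that)
    show "solves g {a..b} (G \<phi>)"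
      using der[OF \<phi>(1)] eq by (auto simp: solves_def)
    show "G \<phi> t0 = q"
      by (rule Gt0)
    show "G \<phi> t \<in> cball p s" if "t \<in> {a..b}" for t
      using ball[OF \<phi>(1) that] .
  qed
qed

text \<open>Near a point, a \<open>C\<^sup>1\<close> field and its derivative are bounded, and the field is therefore Lipschitz there.
  The length \<open>d\<close> of the time interval depends on the point, and in infinite dimensions it need not be
  bounded below on bounded sets.\<close>

lemma C1_on_local_solution_exists:
  fixes f :: "real \<Rightarrow> 'v::banach \<Rightarrow> 'v"
  assumes C1: "C1_on ({0..} \<times> UNIV) (\<lambda>(t, u). f t u)"
    and x: "0 \<le> x" and e: "e > 0"
  obtains d r where "d > 0" "r > 0"
    "\<And>a b t0 q. \<lbrakk>0 \<le> a; a \<le> x; x \<le> b; b - a < d; t0 \<in> {a..b}; norm (q - p) < r\<rbrakk> \<Longrightarrow>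
        \<exists>w. solves f {a..b} w \<and> w t0 = q \<and> (\<forall>t\<in>{a..b}. norm (w t - p) < e)"
proof -
  obtain D where D: "continuous_on ({0..} \<times> UNIV) (\<lambda>(t, u). D t u)"
    "\<And>t u. 0 \<le> t \<Longrightarrow> (f t has_derivative blinfun_apply (D t u)) (at u)"
    using C1_on_state_deriv[OF C1] by metis
  have f: "continuous_on ({0..} \<times> UNIV) (\<lambda>(t, u). f t u)"
    using C1 by (rule C1_on_continuous)
  obtain d1 where d1: "d1 > 0" "\<And>t u. 0 \<le> t \<Longrightarrow> dist (t, u) (x, p) < d1 \<Longrightarrow> norm (f t u - f x p) < 1"
    using continuous_on_iff[THEN iffD1, OF f, rule_format, of "(x, p)" 1] x by (auto simp: dist_norm)
  obtain d2 where d2: "d2 > 0" "\<And>t u. 0 \<le> t \<Longrightarrow> dist (t, u) (x, p) < d2 \<Longrightarrow> norm (D t u - D x p) < 1"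
    using continuous_on_iff[THEN iffD1, OF D(1), rule_format, of "(x, p)" 1] x by (auto simp: dist_norm)
  define s where "s = min (min d1 d2) e / 3"
  define M where "M = max (norm (f x p)) (norm (D x p)) + 1"
  have s: "s > 0" "3 * s \<le> d1" "3 * s \<le> d2" "3 * s \<le> e"
    using d1(1) d2(1) e by (auto simp: s_def)
  have M: "norm (f x p) + 1 \<le> M" "norm (D x p) + 1 \<le> M" "M \<ge> 1"
    using norm_ge_zero[of "f x p"] unfolding M_def by linarith+
  define d where "d = min s (min (1 / M) (s / (2 * M)))"
  have near: "dist (t, u) (x, p) < 3 * s" if "\<bar>t - x\<bar> < s" "u \<in> cball p s" for t u
  proof -
    have "dist (t, u) (x, p) \<le> \<bar>t - x\<bar> + norm (u - p)"
      using norm_Pair_le[of "t - x" "u - p"] by (simp add: dist_norm)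
    then show ?thesis
      using that s(1) by (simp add: dist_norm norm_minus_commute)
  qed
  show ?thesis
  proof (rule that[of d "s / 2"])
    show "d > 0" "s / 2 > 0"
      using s M by (auto simp: d_def)
    fix a b t0 q
    assume ab: "0 \<le> a" "a \<le> x" "x \<le> b" "b - a < d" "t0 \<in> {a..b}" "norm (q - p) < s / 2"
    have tx: "0 \<le> t" "\<bar>t - x\<bar> < s" if "t \<in> {a..b}" for t
      using that ab by (auto simp: d_def)
    have "b - a < s / (2 * M)" "b - a < 1 / M"
      using ab(4) by (auto simp: d_def)
    then have Mab: "M * (b - a) \<le> s / 2" "M * (b - a) < 1"
      using M(3) by (simp_all add: field_simps)
    obtain w where w: "solves f {a..b} w" "w t0 = q" "\<And>t. t \<in> {a..b} \<Longrightarrow> w t \<in> cball p s"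
    proof (rule lipschitz_solution_exists[where g = f and M = M and L = M
          and p = p and s = s and q = q and ?t0.0 = t0 and a = a and b = b])
      show "continuous_on ({a..b} \<times> cball p s) (\<lambda>(t, u). f t u)"
        using f by (rule continuous_on_subset) (use ab(1) in auto)
      show "norm (f t u) \<le> M" if "t \<in> {a..b}" "u \<in> cball p s" for t u
      proof -
        have "norm (f t u - f x p) < 1"
          using d1(2)[OF tx(1)] near[OF tx(2)] that s(2) by (meson order_less_le_trans)
        then show ?thesis
          using M(1) norm_triangle_ineq2[of "f t u" "f x p"] by simp
      qed
      show "norm (f t u - f t v) \<le> M * norm (u - v)"
        if t: "t \<in> {a..b}" and uv: "u \<in> cball p s" "v \<in> cball p s" for t u v
      proof (rule differentiable_bound[OF convex_cball _ _ uv])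
        fix z assume z: "z \<in> cball p s"
        show "(f t has_derivative blinfun_apply (D t z)) (at z within cball p s)"
          using D(2)[OF tx(1)[OF t]] by (rule has_derivative_at_withinI)
        have "norm (D t z - D x p) < 1"
          using d2(2)[OF tx(1)] near[OF tx(2)] t z s(3) by (meson order_less_le_trans)
        then show "onorm (blinfun_apply (D t z)) \<le> M"
          using M(2) norm_triangle_ineq2[of "D t z" "D x p"] by (simp add: norm_blinfun.rep_eq)
      qed
      show "norm (q - p) + M * (b - a) \<le> s"
        using Mab ab(6) by simp
    qed (use Mab M ab in auto)
    have "norm (w t - p) < e" if "t \<in> {a..b}" for t
      using w(3)[OF that] s by (simp add: dist_norm norm_minus_commute)
    then show "\<exists>w. solves f {a..b} w \<and> w t0 = q \<and> (\<forall>t\<in>{a..b}. norm (w t - p) < e)"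
      using w by blast
  qed
qed

section \<open>Weighted norms\<close>

lemma bounded_weight_nonneg:
  assumes "bounded_weight \<Theta> B1 B2"
  shows "0 \<le> B1" "0 \<le> B2"
proof -
  have *: "norm (\<Theta> 0 0) \<le> B1" "bounded_linear (inv (blinfun_apply (\<Theta> 0 0)))"
    "onorm (inv (blinfun_apply (\<Theta> 0 0))) \<le> B2"
    using assms by (auto simp: bounded_weight_def)
  show "0 \<le> B1"
    using norm_ge_zero *(1) by (rule order_trans)
  show "0 \<le> B2"
    using onorm_pos_le[OF *(2)] *(3) by (rule order_trans)
qed

lemma bounded_weight_norm_le:
  assumes "bounded_weight \<Theta> B1 B2" "0 \<le> t"
  shows "norm (blinfun_apply (\<Theta> t u) v) \<le> B1 * norm v"
proof -
  have "norm (blinfun_apply (\<Theta> t u) v) \<le> norm (\<Theta> t u) * norm v"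
    by (rule norm_blinfun)
  also have "\<dots> \<le> B1 * norm v"
    using assms by (intro mult_right_mono) (auto simp: bounded_weight_def)
  finally show ?thesis .
qed

lemma bounded_weight_bij:
  assumes "bounded_weight \<Theta> B1 B2" "0 \<le> t"
  shows "bij (blinfun_apply (\<Theta> t u))"
  using assms by (auto simp: bounded_weight_def GL_def)

lemma bounded_weight_norm_ge:
  assumes "bounded_weight \<Theta> B1 B2" "0 \<le> t"
  shows "norm v \<le> B2 * norm (blinfun_apply (\<Theta> t u) v)"
proof -
  let ?T = "blinfun_apply (\<Theta> t u)"
  have "norm v = norm (inv ?T (?T v))"
    using bounded_weight_bij[OF assms] by (simp add: bij_is_inj)
  also have "\<dots> \<le> onorm (inv ?T) * norm (?T v)"
    using assms by (intro onorm) (auto simp: bounded_weight_def)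
  also have "\<dots> \<le> B2 * norm (?T v)"
    using assms by (intro mult_right_mono) (auto simp: bounded_weight_def)
  finally show ?thesis .
qed

text \<open>The substitution \<open>w = P v\<close> is a bijection between the nonzero vectors, and turns each quotient of one
  supremum into the corresponding quotient of the other.\<close>

lemma weighted_rate_eq_rate_conjugate:
  fixes P P' :: "'v::real_normed_vector \<Rightarrow>\<^sub>L 'w::real_normed_vector"
  assumes "bij (blinfun_apply P)"
  shows "weighted_rate P P' UNIV A =
    rate (\<lambda>w. let v = inv (blinfun_apply P) w in P' v + P (A v))"
proof -
  have inj: "inj (blinfun_apply P)" and surj: "surj (blinfun_apply P)"
    using assms by (auto simp: bij_def)
  have "{w :: 'w. w \<noteq> 0} = blinfun_apply P ` {v. v \<noteq> 0}"
  proof safe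
    fix w :: 'w assume "w \<noteq> 0"
    obtain v where v: "w = P v"
      using surj by (metis surjD)
    then have "v \<noteq> 0"
      using \<open>w \<noteq> 0\<close> by auto
    then show "w \<in> blinfun_apply P ` {v. v \<noteq> 0}"
      using v by blast
  next
    fix v :: 'v assume "v \<noteq> 0" "P v = 0"
    then show False
      using injD[OF inj, of v 0] by simp
  qed
  then show ?thesis
    by (simp add: weighted_rate_def rate_def weighted_norm_def image_image inv_f_f[OF inj] Let_def)
qed

text \<open>Both weighted norms are equivalent to the norm of the state space with constants independent of
  \<open>(t, u)\<close>. Comparing them at time \<open>t\<close> and at time 0 changes the prefactor only. The absolute value of
  the prefactor is taken because a bound that holds trivially, as on a trivial space, may come with a negative one.\<close>

lemma growth_bound_change_weight:
  assumes a: "bounded_weight \<Theta>a A1 A2" and b: "bounded_weight \<Theta>b B1 B2"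
    and g: "growth_bound f \<Theta>a \<mu>"
  shows "growth_bound f \<Theta>b \<mu>"
proof -
  obtain C where C: "\<And>u \<delta> t. solves f {0..} u \<Longrightarrow> solves (\<lambda>t. state_deriv f t (u t)) {0..} \<delta> \<Longrightarrow> 0 \<le> t \<Longrightarrow>
      norm (\<Theta>a t (u t) (\<delta> t)) \<le> C * exp (\<mu> * t) * norm (\<Theta>a 0 (u 0) (\<delta> 0))"
    using g unfolding growth_bound_def weighted_norm_def by blast
  note nonneg = bounded_weight_nonneg[OF a] bounded_weight_nonneg[OF b]
  have "norm (\<Theta>b t (u t) (\<delta> t)) \<le> (B1 * A2 * \<bar>C\<bar> * A1 * B2) * exp (\<mu> * t) * norm (\<Theta>b 0 (u 0) (\<delta> 0))"
    if u: "solves f {0..} u" "solves (\<lambda>t. state_deriv f t (u t)) {0..} \<delta>" and t: "0 \<le> t" for u \<delta> t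
  proof -
    have "norm (\<Theta>b t (u t) (\<delta> t)) \<le> B1 * norm (\<delta> t)"
      by (rule bounded_weight_norm_le[OF b t])
    also have "\<dots> \<le> B1 * (A2 * norm (\<Theta>a t (u t) (\<delta> t)))"
      using bounded_weight_norm_ge[OF a t] nonneg by (intro mult_left_mono) auto
    also have "\<dots> \<le> B1 * (A2 * (C * exp (\<mu> * t) * norm (\<Theta>a 0 (u 0) (\<delta> 0))))"
      using C[OF u t] nonneg by (intro mult_left_mono) auto
    also have "\<dots> \<le> B1 * (A2 * (\<bar>C\<bar> * exp (\<mu> * t) * norm (\<Theta>a 0 (u 0) (\<delta> 0))))"
      using nonneg by (intro mult_left_mono mult_right_mono) auto
    also have "\<dots> \<le> B1 * (A2 * (\<bar>C\<bar> * exp (\<mu> * t) * (A1 * norm (\<delta> 0))))"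
      using bounded_weight_norm_le[OF a order_refl] nonneg by (intro mult_left_mono) auto
    also have "\<dots> \<le> B1 * (A2 * (\<bar>C\<bar> * exp (\<mu> * t) * (A1 * (B2 * norm (\<Theta>b 0 (u 0) (\<delta> 0))))))"
      using bounded_weight_norm_ge[OF b order_refl] nonneg by (intro mult_left_mono) auto
    finally show ?thesis
      by (simp add: mult_ac)
  qed
  then show ?thesis
    unfolding growth_bound_def weighted_norm_def by blast
qed

section \<open>Contraction of solutions\<close>

locale contracting_cauchy_problem =
  fixes f :: "real \<Rightarrow> 'v \<Rightarrow> 'v::banach"
    and \<Theta> :: "real \<Rightarrow> 'v \<Rightarrow> ('v \<Rightarrow>\<^sub>L 'w::banach)"
    and B1 B2 \<rho> :: real
  assumes f: "C1_on ({0..} \<times> UNIV) (\<lambda>(t, u). f t u)"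
    and \<Theta>: "bounded_weight \<Theta> B1 B2"
    and rate: "\<And>t u. 0 \<le> t \<Longrightarrow>
      weighted_rate (\<Theta> t u) (flow_deriv f \<Theta> t u) UNIV (state_deriv f t u) \<le> ereal \<rho>"
begin

lemmas B_nonneg = bounded_weight_nonneg[OF \<Theta>]

text \<open>The hypothesis on the rates as a linear bound, which also covers \<open>v = 0\<close> because both sides vanish there.\<close>

lemma norm_dir_weighted_le:
  assumes t: "0 \<le> t"
  shows "norm_dir (\<Theta> t u v) (flow_deriv f \<Theta> t u v + \<Theta> t u (state_deriv f t u v))
    \<le> \<rho> * norm (\<Theta> t u v)"
proof (cases "v = 0")
  case True
  obtain D where "state_deriv f t u = blinfun_apply (D t u)"
    using C1_on_state_deriv[OF f] t by metis
  then show ?thesis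
    using True by simp
next
  case False
  let ?N = "norm_dir (\<Theta> t u v) (flow_deriv f \<Theta> t u v + \<Theta> t u (state_deriv f t u v))"
  have pos: "norm (\<Theta> t u v) > 0"
    using bounded_weight_norm_ge[OF \<Theta> t, of v u] False by (cases "norm (\<Theta> t u v) = 0") auto
  have "ereal (norm (\<Theta> t u v) * ?N / (norm (\<Theta> t u v))\<^sup>2)
      \<le> weighted_rate (\<Theta> t u) (flow_deriv f \<Theta> t u) UNIV (state_deriv f t u)"
    unfolding weighted_rate_def semi_inner_eq weighted_norm_def
    by (rule SUP_upper2[of v]) (use False in auto)
  also have "\<dots> \<le> ereal \<rho>"
    by (rule rate[OF t])
  finally show ?thesis
    using pos by (simp add: power2_eq_square field_simps)
qed

text \<open>The difference \<open>\<delta> = v - u\<close> of two close solutions is nearly a tangent vector along \<open>u\<close>: it satisfies the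
  linearized equation up to an error \<open>\<le> \<epsilon> \<parallel>\<delta>\<parallel>\<close>, uniformly along the compact trajectory. The derivative of
  \<open>\<Theta>(t, u) \<delta>\<close> then has the weighted rate at most \<open>\<rho>\<close>, up to the error \<open>B1 * B2 * \<epsilon> \<le> e\<close>. This replaces the
  variational equation, so that differentiability in the initial value need not be established. The estimate
  holds on all subintervals on which \<open>v\<close> stays close, with a single distance \<open>\<eta>\<close>; this uniformity is what makes
  arguments that concatenate time intervals possible.\<close>

lemma close_solutions_contract:
  assumes u: "solves f {A..B} u" and A: "0 \<le> A" and e: "e > 0"
  obtains \<eta> where "\<eta> > 0"
    "\<And>a b v. \<lbrakk>A \<le> a; a \<le> b; b \<le> B; solves f {a..b} v; \<And>t. t \<in> {a..b} \<Longrightarrow> norm (v t - u t) < \<eta>\<rbrakk> \<Longrightarrow>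
       norm (v b - u b) \<le> B1 * B2 * exp ((\<rho> + e) * (b - a)) * norm (v a - u a)"
proof -
  obtain D where D: "continuous_on ({0..} \<times> UNIV) (\<lambda>(t, u). D t u)"
    "\<And>t u. 0 \<le> t \<Longrightarrow> (f t has_derivative blinfun_apply (D t u)) (at u)"
    "\<And>t u. 0 \<le> t \<Longrightarrow> state_deriv f t u = blinfun_apply (D t u)"
    using C1_on_state_deriv[OF f] by metis
  \<comment> \<open>The summand 1 is there because \<open>B1 * B2\<close> may vanish on a trivial space.\<close>
  define \<epsilon> where "\<epsilon> = e / (B1 * B2 + 1)"
  have B12: "0 \<le> B1 * B2"
    using B_nonneg by simp
  then have \<epsilon>: "\<epsilon> > 0" "B1 * B2 * \<epsilon> \<le> e"
    using e by (auto simp: \<epsilon>_def field_simps)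
  obtain \<eta> where \<eta>: "\<eta> > 0" "\<And>x y. x \<in> (\<lambda>t. (t, u t)) ` {A..B} \<Longrightarrow> y \<in> {0..} \<times> UNIV \<Longrightarrow> dist y x < \<eta>
      \<Longrightarrow> dist ((\<lambda>(t, u). D t u) y) ((\<lambda>(t, u). D t u) x) < \<epsilon>"
    by (rule continuous_on_near_compact[OF D(1) compact_graph[OF solves_continuous_on[OF u]] _ \<epsilon>(1)])
      (use A in auto)
  show ?thesis
  proof (rule that[OF \<eta>(1)])
    fix a b v
    assume ab: "A \<le> a" "a \<le> b" "b \<le> B" and v: "solves f {a..b} v"
      and near: "\<And>t. t \<in> {a..b} \<Longrightarrow> norm (v t - u t) < \<eta>"
    define y where "y = (\<lambda>t. \<Theta> t (u t) (v t - u t))"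
    define z where "z = (\<lambda>t. \<Theta> t (u t) (f t (v t) - f t (u t)) + flow_deriv f \<Theta> t (u t) (v t - u t))"
    have u': "solves f {a..b} u"
      using u by (rule solves_subset) (use ab in auto)
    have t0: "0 \<le> t" if "t \<in> {a..b}" for t
      using that A ab by auto
    have "norm (y b) \<le> exp ((\<rho> + e) * (b - a)) * norm (y a)"
    proof (rule norm_growth_le[where y = y and z = z, OF ab(2)])
      fix t assume t: "t \<in> {a..b}"
      have "((\<lambda>t. v t - u t) has_vector_derivative f t (v t) - f t (u t)) (at t within {a..b})"
        using u' v t by (intro has_vector_derivative_diff) (auto simp: solves_def)
      moreover have "((\<lambda>t. \<Theta> t (u t)) has_vector_derivative flow_deriv f \<Theta> t (u t)) (at t within {a..b})"
        using \<Theta> u' t0 t by (intro C1_on_derivative_along_solution) (auto simp: bounded_weight_def)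
      ultimately show "(y has_vector_derivative z t) (at t within {a..b})"
        unfolding y_def z_def
        by (intro bounded_bilinear.has_vector_derivative[OF bounded_bilinear_blinfun_apply])
    next
      fix t assume t: "t \<in> {a..b}"
      define \<delta> where "\<delta> = v t - u t"
      define r where "r = f t (v t) - f t (u t) - D t (u t) \<delta>"
      have "norm r \<le> norm \<delta> * \<epsilon>"
        unfolding r_def \<delta>_def
      proof (rule differentiable_bound_linearization[where S = "ball (u t) \<eta>" and f = "f t" and
            f' = "\<lambda>w. blinfun_apply (D t w)" and ?x0.0 = "u t"])
        fix s :: real assume "s \<in> {0..1}"
        then have "norm (s *\<^sub>R (v t - u t)) \<le> norm (v t - u t)"
          by (simp add: mult_left_le_one_le)
        then show "u t + s *\<^sub>R (v t - u t) \<in> ball (u t) \<eta>"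
          using near[OF t] by (simp add: dist_norm)
      next
        fix w assume w: "w \<in> ball (u t) \<eta>"
        show "(f t has_derivative blinfun_apply (D t w)) (at w within ball (u t) \<eta>)"
          using D(2)[OF t0[OF t]] by (rule has_derivative_at_withinI)
        have "norm (D t w - D t (u t)) < \<epsilon>"
          using \<eta>(2)[of "(t, u t)" "(t, w)"] w t ab t0[OF t]
          by (auto simp: dist_Pair_Pair dist_norm norm_minus_commute)
        then show "onorm (blinfun_apply (D t w) - blinfun_apply (D t (u t))) \<le> \<epsilon>"
          by (simp add: norm_blinfun.rep_eq minus_blinfun.rep_eq fun_diff_def)
      qed (use \<eta>(1) in simp)
      then have "norm (\<Theta> t (u t) r) \<le> B1 * (norm \<delta> * \<epsilon>)"
        using bounded_weight_norm_le[OF \<Theta> t0[OF t], of "u t" r] B_nonneg(1)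
        by (meson mult_left_mono order_trans)
      also have "\<dots> \<le> B1 * ((B2 * norm (y t)) * \<epsilon>)"
        using bounded_weight_norm_ge[OF \<Theta> t0[OF t], of \<delta> "u t"] B_nonneg(1) \<epsilon>(1)
        by (intro mult_left_mono mult_right_mono) (auto simp: y_def \<delta>_def)
      also have "\<dots> = (B1 * B2 * \<epsilon>) * norm (y t)"
        by simp
      also have "\<dots> \<le> e * norm (y t)"
        using \<epsilon>(2) by (rule mult_right_mono) simp
      finally have r: "norm (\<Theta> t (u t) r) \<le> e * norm (y t)" .
      have fd: "f t (v t) - f t (u t) = D t (u t) \<delta> + r"
        by (simp add: r_def)
      have "z t = (flow_deriv f \<Theta> t (u t) \<delta> + \<Theta> t (u t) (state_deriv f t (u t) \<delta>)) + \<Theta> t (u t) r"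
        unfolding z_def fd \<delta>_def[symmetric] D(3)[OF t0[OF t]] by (simp add: blinfun.add_right)
      then have "norm_dir (y t) (z t)
          \<le> norm_dir (y t) (flow_deriv f \<Theta> t (u t) \<delta> + \<Theta> t (u t) (state_deriv f t (u t) \<delta>))
            + norm (\<Theta> t (u t) r)"
        by (simp only: norm_dir_add_le)
      also have "\<dots> \<le> \<rho> * norm (y t) + e * norm (y t)"
        using norm_dir_weighted_le[OF t0[OF t], of "u t" \<delta>] r
        by (intro add_mono) (auto simp: y_def \<delta>_def)
      finally show "norm_dir (y t) (z t) \<le> (\<rho> + e) * norm (y t)"
        by (simp add: distrib_right)
    qed
    also have "norm (y a) \<le> B1 * norm (v a - u a)"
      unfolding y_def using ab A by (intro bounded_weight_norm_le[OF \<Theta>]) auto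
    finally have yb: "norm (y b) \<le> exp ((\<rho> + e) * (b - a)) * (B1 * norm (v a - u a))"
      by simp
    have "norm (v b - u b) \<le> B2 * norm (y b)"
      unfolding y_def using ab A by (intro bounded_weight_norm_ge[OF \<Theta>]) auto
    also have "\<dots> \<le> B2 * (exp ((\<rho> + e) * (b - a)) * (B1 * norm (v a - u a)))"
      using yb B_nonneg(2) by (rule mult_left_mono)
    finally show "norm (v b - u b) \<le> B1 * B2 * exp ((\<rho> + e) * (b - a)) * norm (v a - u a)"
      by (simp add: mult_ac)
  qed
qed

text \<open>Where the two solutions agree they stay close for some time, and close solutions with the same initial
  value coincide; where they differ they differ nearby.\<close>

lemma solution_unique:
  assumes u: "solves f {A..B} u" and v: "solves f {A..B} v" and A: "0 \<le> A"
    and eq: "u A = v A" and t: "t \<in> {A..B}"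
  shows "u t = v t"
proof -
  define w where "w = (\<lambda>t. v t - u t)"
  obtain \<eta> where \<eta>: "\<eta> > 0"
    "\<And>a b v. \<lbrakk>A \<le> a; a \<le> b; b \<le> B; solves f {a..b} v; \<And>t. t \<in> {a..b} \<Longrightarrow> norm (v t - u t) < \<eta>\<rbrakk> \<Longrightarrow>
       norm (v b - u b) \<le> B1 * B2 * exp ((\<rho> + 1) * (b - a)) * norm (v a - u a)"
    using close_solutions_contract[OF u A zero_less_one] by metis
  have cont: "continuous_on {A..B} w"
    unfolding w_def using u v by (intro continuous_intros solves_continuous_on)
  have "A \<le> t"
    using t by simp
  then have "A \<le> A \<and> A \<le> t \<and> t \<le> t \<and> w A = 0 \<longrightarrow> w t = 0"
  proof (induction rule: Bolzano[where P = "\<lambda>a b. A \<le> a \<and> a \<le> b \<and> b \<le> t \<and> w a = 0 \<longrightarrow> w b = 0"])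
    case (local x)
    then have x: "x \<in> {A..B}"
      using t by auto
    show ?case
    proof (cases "w x = 0")
      case True
      obtain d where d: "d > 0" "\<And>s. s \<in> {A..B} \<Longrightarrow> dist s x < d \<Longrightarrow> dist (w s) (w x) < \<eta>"
        using continuous_on_iff[THEN iffD1, rule_format, OF cont x \<eta>(1)] by auto
      have "w b = 0" if ab: "a \<le> x" "x \<le> b" "b - a < d" "A \<le> a" "b \<le> t" "w a = 0" for a b
      proof -
        have "norm (v s - u s) < \<eta>" if "s \<in> {a..b}" for s
          using d(2)[of s] that ab t True by (auto simp: dist_norm w_def)
        then have "norm (v b - u b) \<le> B1 * B2 * exp ((\<rho> + 1) * (b - a)) * norm (v a - u a)"
          using ab t by (intro \<eta>(2) solves_subset[OF v]) auto
        then show ?thesis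
          using ab(6) by (simp add: w_def)
      qed
      then show ?thesis
        using d(1) by blast
    next
      case False
      then obtain d where d: "d > 0" "\<And>s. s \<in> {A..B} \<Longrightarrow> dist s x < d \<Longrightarrow> dist (w s) (w x) < norm (w x)"
        using continuous_on_iff[THEN iffD1, rule_format, OF cont x, of "norm (w x)"] by auto
      have "w a \<noteq> 0" if "a \<le> x" "x \<le> b" "b - a < d" "A \<le> a" for a b
        using d(2)[of a] that x by (auto simp: dist_norm)
      then show ?thesis
        using d(1) by blast
    qed
  qed auto
  then show ?thesis
    using eq \<open>A \<le> t\<close> by (simp add: w_def)
qed

text \<open>A solution on a given compact time interval is stable: nearby initial values have solutions on the same
  interval. Local existence along the trajectory provides them on short intervals, and
  \<open>close_solutions_contract\<close> keeps their distance to \<open>u\<close> under control when these are concatenated.\<close>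

lemma solutions_from_nearby_points:
  assumes u: "solves f {A..B} u" and A: "0 \<le> A" and AB: "A \<le> B" and e: "e > 0"
  obtains r where "r > 0"
    "\<And>q. norm (q - u A) < r \<Longrightarrow> \<exists>w. solves f {A..B} w \<and> w A = q \<and>
        (\<forall>t\<in>{A..B}. norm (w t - u t) \<le> B1 * B2 * exp ((\<rho> + e) * (t - A)) * norm (q - u A))"
proof -
  obtain \<eta> where \<eta>: "\<eta> > 0"
    "\<And>a b v. \<lbrakk>A \<le> a; a \<le> b; b \<le> B; solves f {a..b} v; \<And>t. t \<in> {a..b} \<Longrightarrow> norm (v t - u t) < \<eta>\<rbrakk> \<Longrightarrow>
       norm (v b - u b) \<le> B1 * B2 * exp ((\<rho> + e) * (b - a)) * norm (v a - u a)"
    using close_solutions_contract[OF u A e] by metis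
  have cont: "continuous_on {A..B} u"
    using u by (rule solves_continuous_on)
  define P where "P a b \<longleftrightarrow> (A \<le> a \<and> a \<le> b \<and> b \<le> B \<longrightarrow> (\<exists>r>0. \<forall>q. norm (q - u a) < r \<longrightarrow>
    (\<exists>w. solves f {a..b} w \<and> w a = q \<and> (\<forall>t\<in>{a..b}. norm (w t - u t) < \<eta>))))" for a b
  have "P A B"
    using AB
  proof (induction rule: Bolzano)
    case (trans a b c)
    show ?case
      unfolding P_def
    proof
      assume ac: "A \<le> a \<and> a \<le> c \<and> c \<le> B"
      then have *: "A \<le> a \<and> a \<le> b \<and> b \<le> B" "A \<le> b \<and> b \<le> c \<and> c \<le> B"
        using trans(3,4) by auto
      obtain r1 where r1: "r1 > 0" "\<And>q. norm (q - u a) < r1 \<Longrightarrow>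
          \<exists>w. solves f {a..b} w \<and> w a = q \<and> (\<forall>t\<in>{a..b}. norm (w t - u t) < \<eta>)"
        using trans(1)[unfolded P_def, THEN mp, OF *(1)] by blast
      obtain r2 where r2: "r2 > 0" "\<And>q. norm (q - u b) < r2 \<Longrightarrow>
          \<exists>w. solves f {b..c} w \<and> w b = q \<and> (\<forall>t\<in>{b..c}. norm (w t - u t) < \<eta>)"
        using trans(2)[unfolded P_def, THEN mp, OF *(2)] by blast
      define L where "L = B1 * B2 * exp ((\<rho> + e) * (b - a)) + 1"
      have L: "L > 0"
        using B_nonneg by (simp add: L_def add_nonneg_pos)
      have "\<exists>w. solves f {a..c} w \<and> w a = q \<and> (\<forall>t\<in>{a..c}. norm (w t - u t) < \<eta>)"
        if q: "norm (q - u a) < min r1 (r2 / L)" for q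
      proof -
        obtain w1 where w1: "solves f {a..b} w1" "w1 a = q" "\<And>t. t \<in> {a..b} \<Longrightarrow> norm (w1 t - u t) < \<eta>"
          using r1(2)[of q] q by auto
        have "norm (w1 b - u b) \<le> B1 * B2 * exp ((\<rho> + e) * (b - a)) * norm (q - u a)"
          using \<eta>(2)[OF _ _ _ w1(1) w1(3)] w1(2) trans ac by auto
        also have "\<dots> \<le> L * norm (q - u a)"
          by (simp add: L_def mult_right_mono)
        also have "\<dots> < r2"
          using q L by (simp add: field_simps)
        finally obtain w2 where w2: "solves f {b..c} w2" "w2 b = w1 b" "\<And>t. t \<in> {b..c} \<Longrightarrow> norm (w2 t - u t) < \<eta>"
          using r2(2) by metis
        show ?thesis
          using solves_concat[OF w1(1) w2(1) w2(2)[symmetric] trans(3,4)] w1 w2 trans(3,4)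
          by (intro exI[of _ "\<lambda>t. if t \<le> b then w1 t else w2 t"]) auto
      qed
      then show "\<exists>r>0. \<forall>q. norm (q - u a) < r \<longrightarrow>
          (\<exists>w. solves f {a..c} w \<and> w a = q \<and> (\<forall>t\<in>{a..c}. norm (w t - u t) < \<eta>))"
        using r1(1) r2(1) L by (intro exI[of _ "min r1 (r2 / L)"]) auto
    qed
  next
    case (local x)
    then have x: "x \<in> {A..B}" "0 \<le> x"
      using A by auto
    obtain d r where d: "d > 0" "r > 0"
      "\<And>a b t0 q. \<lbrakk>0 \<le> a; a \<le> x; x \<le> b; b - a < d; t0 \<in> {a..b}; norm (q - u x) < r\<rbrakk> \<Longrightarrow>
        \<exists>w. solves f {a..b} w \<and> w t0 = q \<and> (\<forall>t\<in>{a..b}. norm (w t - u x) < \<eta> / 2)"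
      using C1_on_local_solution_exists[OF f x(2), of "\<eta> / 2" "u x"] \<eta>(1) by (metis half_gt_zero)
    obtain d' where d': "d' > 0" "\<And>s. s \<in> {A..B} \<Longrightarrow> dist s x < d' \<Longrightarrow> dist (u s) (u x) < min (r / 2) (\<eta> / 2)"
      using continuous_on_iff[THEN iffD1, rule_format, OF cont x(1), of "min (r / 2) (\<eta> / 2)"] d(2) \<eta>(1)
      by auto
    have "P a b" if ab: "a \<le> x" "x \<le> b" "b - a < min d d'" for a b
      unfolding P_def
    proof
      assume AB: "A \<le> a \<and> a \<le> b \<and> b \<le> B"
      have us: "norm (u s - u x) < r / 2" "norm (u s - u x) < \<eta> / 2" if "s \<in> {a..b}" for s
        using d'(2)[of s] that ab AB by (auto simp: dist_norm)
      have "\<exists>w. solves f {a..b} w \<and> w a = q \<and> (\<forall>t\<in>{a..b}. norm (w t - u t) < \<eta>)"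
        if q: "norm (q - u a) < r / 2" for q
      proof -
        have "norm (q - u x) < r"
          using q us(1)[of a] AB norm_triangle_ineq[of "q - u a" "u a - u x"] by simp
        then obtain w where w: "solves f {a..b} w" "w a = q" "\<And>t. t \<in> {a..b} \<Longrightarrow> norm (w t - u x) < \<eta> / 2"
          using d(3)[of a b a q] ab AB A by auto
        have "norm (w t - u t) < \<eta>" if "t \<in> {a..b}" for t
          using w(3)[OF that] us(2)[OF that] norm_triangle_ineq4[of "w t - u x" "u t - u x"] by simp
        then show ?thesis
          using w by blast
      qed
      then show "\<exists>r>0. \<forall>q. norm (q - u a) < r \<longrightarrow>
          (\<exists>w. solves f {a..b} w \<and> w a = q \<and> (\<forall>t\<in>{a..b}. norm (w t - u t) < \<eta>))"
        using d(2) by (intro exI[of _ "r / 2"]) auto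
    qed
    then show ?case
      using d(1) d'(1) by (intro exI[of _ "min d d'"]) auto
  qed
  then obtain r where r: "r > 0" "\<And>q. norm (q - u A) < r \<Longrightarrow>
      \<exists>w. solves f {A..B} w \<and> w A = q \<and> (\<forall>t\<in>{A..B}. norm (w t - u t) < \<eta>)"
    using AB unfolding P_def by auto
  show ?thesis
  proof (rule that[OF r(1)])
    fix q assume "norm (q - u A) < r"
    then obtain w where w: "solves f {A..B} w" "w A = q" "\<And>t. t \<in> {A..B} \<Longrightarrow> norm (w t - u t) < \<eta>"
      using r(2) by blast
    have "norm (w t - u t) \<le> B1 * B2 * exp ((\<rho> + e) * (t - A)) * norm (w A - u A)" if "t \<in> {A..B}" for t
      using that w by (intro \<eta>(2) solves_subset[OF w(1)]) auto
    then show "\<exists>w. solves f {A..B} w \<and> w A = q \<and>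
        (\<forall>t\<in>{A..B}. norm (w t - u t) \<le> B1 * B2 * exp ((\<rho> + e) * (t - A)) * norm (q - u A))"
      using w by auto
  qed
qed

text \<open>The initial value is moved along the segment \<open>\<gamma>\<close> from \<open>u A\<close> to \<open>q\<close>. The solutions \<open>\<phi> s\<close> starting at \<open>\<gamma> s\<close> depend
  on \<open>s\<close> in a locally Lipschitz way with the same constant everywhere, hence in a Lipschitz way as long as they
  exist. The set of parameters for which they exist cannot end before 1: it is open by
  \<open>solutions_from_nearby_points\<close>, and at a limit of parameters the solutions converge uniformly, to a solution.
  The contraction estimate between the end points, which need not be close to each other, comes with it.\<close>

lemma solution_from_any_point:
  assumes u: "solves f {A..B} u" and A: "0 \<le> A" and AB: "A \<le> B" and e: "e > 0"
  obtains w where "solves f {A..B} w" "w A = q"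
    "\<And>t. t \<in> {A..B} \<Longrightarrow> norm (w t - u t) \<le> B1 * B2 * exp ((\<rho> + e) * (t - A)) * norm (q - u A)"
proof -
  define \<gamma> where "\<gamma> s = u A + s *\<^sub>R (q - u A)" for s :: real
  define \<Lambda> where "\<Lambda> t = B1 * B2 * exp ((\<rho> + e) * (t - A))" for t
  define E where "E s \<longleftrightarrow> (\<exists>w. solves f {A..B} w \<and> w A = \<gamma> s)" for s
  define \<phi> where "\<phi> s = (SOME w. solves f {A..B} w \<and> w A = \<gamma> s)" for s
  have \<phi>: "solves f {A..B} (\<phi> s)" "\<phi> s A = \<gamma> s" if "E s" for s
    using someI_ex[of "\<lambda>w. solves f {A..B} w \<and> w A = \<gamma> s"] that by (auto simp: E_def \<phi>_def)
  have \<phi>_unique: "\<phi> s t = w t" if "solves f {A..B} w" "w A = \<gamma> s" "t \<in> {A..B}" for s w t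
    using solution_unique[OF \<phi>(1) that(1) A, of s t] \<phi>(2)[of s] that by (auto simp: E_def)
  have \<gamma>_diff: "\<gamma> s - \<gamma> x = (s - x) *\<^sub>R (q - u A)" for s x
    by (simp add: \<gamma>_def algebra_simps)
  have near: "\<exists>d>0. \<forall>s. \<bar>s - x\<bar> < d \<longrightarrow>
      E s \<and> (\<forall>t\<in>{A..B}. norm (\<phi> s t - \<phi> x t) \<le> \<Lambda> t * (\<bar>s - x\<bar> * norm (q - u A)))" if Ex: "E x" for x
  proof -
    obtain r where r: "r > 0" "\<And>q. norm (q - \<phi> x A) < r \<Longrightarrow> \<exists>w. solves f {A..B} w \<and> w A = q \<and>
        (\<forall>t\<in>{A..B}. norm (w t - \<phi> x t) \<le> B1 * B2 * exp ((\<rho> + e) * (t - A)) * norm (q - \<phi> x A))"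
      using solutions_from_nearby_points[OF \<phi>(1)[OF Ex] A AB e] by blast
    have "E s \<and> (\<forall>t\<in>{A..B}. norm (\<phi> s t - \<phi> x t) \<le> \<Lambda> t * (\<bar>s - x\<bar> * norm (q - u A)))"
      if s: "\<bar>s - x\<bar> < r / (norm (q - u A) + 1)" for s
    proof -
      have "\<bar>s - x\<bar> * (norm (q - u A) + 1) < r"
        using s by (simp add: pos_less_divide_eq add_nonneg_pos)
      then have "norm (\<gamma> s - \<phi> x A) < r"
        using \<phi>(2)[OF Ex] by (simp add: \<gamma>_diff distrib_left)
      then obtain w where w: "solves f {A..B} w" "w A = \<gamma> s"
        "\<And>t. t \<in> {A..B} \<Longrightarrow> norm (w t - \<phi> x t) \<le> \<Lambda> t * norm (\<gamma> s - \<phi> x A)"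
        using r(2) unfolding \<Lambda>_def by blast
      then show ?thesis
        using \<phi>_unique[OF w(1,2)] \<phi>(2)[OF Ex] by (auto simp: E_def \<gamma>_diff)
    qed
    then show ?thesis
      using r(1) by (intro exI[of _ "r / (norm (q - u A) + 1)"]) (auto simp: add_nonneg_pos)
  qed
  have lip: "norm (\<phi> b t - \<phi> a t) \<le> \<Lambda> t * ((b - a) * norm (q - u A))"
    if ab: "a \<le> b" and E: "\<And>s. s \<in> {a..b} \<Longrightarrow> E s" and t: "t \<in> {A..B}" for a b t
  proof -
    have "a \<le> a \<and> a \<le> b \<and> b \<le> b \<longrightarrow> norm (\<phi> b t - \<phi> a t) \<le> \<Lambda> t * ((b - a) * norm (q - u A))"
      using ab
    proof (induction rule: Bolzano[where P = "\<lambda>a' b'. a \<le> a' \<and> a' \<le> b' \<and> b' \<le> b \<longrightarrow>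
          norm (\<phi> b' t - \<phi> a' t) \<le> \<Lambda> t * ((b' - a') * norm (q - u A))"])
      case (trans x y z)
      show ?case
      proof
        assume "a \<le> x \<and> x \<le> z \<and> z \<le> b"
        then have "norm (\<phi> y t - \<phi> x t) + norm (\<phi> z t - \<phi> y t)
            \<le> \<Lambda> t * ((y - x) * norm (q - u A)) + \<Lambda> t * ((z - y) * norm (q - u A))"
          using trans by (intro add_mono) auto
        then show "norm (\<phi> z t - \<phi> x t) \<le> \<Lambda> t * ((z - x) * norm (q - u A))"
          using norm_triangle_ineq[of "\<phi> y t - \<phi> x t" "\<phi> z t - \<phi> y t"] by (simp add: algebra_simps)
      qed
    next
      case (local x)
      then obtain d where d: "d > 0" "\<And>s. \<bar>s - x\<bar> < d \<Longrightarrow>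
          norm (\<phi> s t - \<phi> x t) \<le> \<Lambda> t * (\<bar>s - x\<bar> * norm (q - u A))"
        using near[OF E[of x]] t by auto
      have "norm (\<phi> z t - \<phi> y t) \<le> \<Lambda> t * ((z - y) * norm (q - u A))"
        if "y \<le> x" "x \<le> z" "z - y < d" for y z
      proof -
        have "norm (\<phi> z t - \<phi> x t) + norm (\<phi> y t - \<phi> x t)
            \<le> \<Lambda> t * (\<bar>z - x\<bar> * norm (q - u A)) + \<Lambda> t * (\<bar>y - x\<bar> * norm (q - u A))"
          using that by (intro add_mono d(2)) auto
        then show ?thesis
          using norm_triangle_ineq4[of "\<phi> z t - \<phi> x t" "\<phi> y t - \<phi> x t"] that
          by (simp add: algebra_simps)
      qed
      then show ?case
        using d(1) by blast
    qed
    then show ?thesis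
      using ab by simp
  qed
  \<comment> \<open>A bound for the Lipschitz constants that is uniform in time.\<close>
  define C where "C = B1 * B2 * exp (\<bar>\<rho> + e\<bar> * (B - A)) * norm (q - u A)"
  have C0: "0 \<le> C"
    using B_nonneg by (simp add: C_def)
  have C: "\<Lambda> t * (h * norm (q - u A)) \<le> C * h" if "t \<in> {A..B}" "0 \<le> h" for t h
  proof -
    have "(\<rho> + e) * (t - A) \<le> \<bar>\<rho> + e\<bar> * (B - A)"
      using that by (intro mult_mono) auto
    then have "\<Lambda> t \<le> B1 * B2 * exp (\<bar>\<rho> + e\<bar> * (B - A))"
      unfolding \<Lambda>_def using B_nonneg by (intro mult_left_mono) auto
    then have "\<Lambda> t * (h * norm (q - u A)) \<le> B1 * B2 * exp (\<bar>\<rho> + e\<bar> * (B - A)) * (h * norm (q - u A))"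
      using that by (intro mult_right_mono) auto
    then show ?thesis
      by (simp add: C_def mult_ac)
  qed
  have E: "E s" if "0 \<le> s" "s \<le> 1" for s
  proof (rule real_induction[where a = 0 and b = 1 and P = E])
    show "E 0"
      using u by (auto simp: E_def \<gamma>_def)
  next
    fix x :: real assume x: "0 \<le> x" and *: "\<And>y. 0 \<le> y \<Longrightarrow> y \<le> x \<Longrightarrow> E y"
    obtain d where "d > 0" "\<And>s. \<bar>s - x\<bar> < d \<Longrightarrow> E s"
      using near[OF *[OF x order_refl]] by blast
    then show "\<exists>d>0. \<forall>y. x < y \<and> y < x + d \<and> y \<le> 1 \<longrightarrow> E y"
      by (intro exI[of _ d]) auto
  next
    fix x :: real assume x: "0 < x" and *: "\<And>y. 0 \<le> y \<Longrightarrow> y < x \<Longrightarrow> E y"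
    define \<sigma> where "\<sigma> n = x - x / real (Suc n)" for n
    have \<sigma>: "0 \<le> \<sigma> n" "\<sigma> n < x" for n
      using x by (auto simp: \<sigma>_def field_simps)
    have lim\<sigma>: "\<sigma> \<longlonglongrightarrow> x"
      unfolding \<sigma>_def using tendsto_diff[OF tendsto_const LIMSEQ_Suc[OF lim_const_over_n[of x]], of x] by simp
    have le: "dist (\<phi> (\<sigma> m) t) (\<phi> (\<sigma> n) t) \<le> C * \<bar>\<sigma> m - \<sigma> n\<bar>" if t: "t \<in> {A..B}" for m n t
    proof -
      have "dist (\<phi> b t) (\<phi> a t) \<le> C * \<bar>b - a\<bar>" if "0 \<le> a" "a \<le> b" "b < x" for a b
        using lip[OF that(2) _ t] C[OF t, of "b - a"] * that unfolding dist_norm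
        by (smt (verit) atLeastAtMost_iff)
      from this[of "\<sigma> n" "\<sigma> m"] this[of "\<sigma> m" "\<sigma> n"] show ?thesis
        using \<sigma>[of m] \<sigma>[of n] by (cases "\<sigma> n \<le> \<sigma> m") (auto simp: dist_commute abs_minus_commute)
    qed
    have "uniformly_Cauchy_on {A..B} (\<lambda>n. \<phi> (\<sigma> n))"
    proof (rule uniformly_Cauchy_onI)
      fix \<epsilon> :: real assume \<epsilon>: "\<epsilon> > 0"
      have "Cauchy \<sigma>"
        using lim\<sigma> by (rule LIMSEQ_imp_Cauchy)
      moreover have "\<epsilon> / (C + 1) > 0"
        using \<epsilon> C0 by simp
      ultimately obtain M where M: "\<And>m n. m \<ge> M \<Longrightarrow> n \<ge> M \<Longrightarrow> dist (\<sigma> m) (\<sigma> n) < \<epsilon> / (C + 1)"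
        unfolding Cauchy_def by blast
      have "dist (\<phi> (\<sigma> m) t) (\<phi> (\<sigma> n) t) < \<epsilon>" if "t \<in> {A..B}" "m \<ge> M" "n \<ge> M" for t m n
      proof -
        have "C * \<bar>\<sigma> m - \<sigma> n\<bar> \<le> (C + 1) * \<bar>\<sigma> m - \<sigma> n\<bar>"
          by (intro mult_right_mono) auto
        also have "\<dots> < \<epsilon>"
          using M[OF that(2,3)] C0 by (simp add: dist_real_def field_simps)
        finally show ?thesis
          using le[OF that(1), of m n] by simp
      qed
      then show "\<exists>M. \<forall>t\<in>{A..B}. \<forall>m\<ge>M. \<forall>n\<ge>M. dist (\<phi> (\<sigma> m) t) (\<phi> (\<sigma> n) t) < \<epsilon>"
        by blast
    qed
    then obtain w where w: "uniform_limit {A..B} (\<lambda>n. \<phi> (\<sigma> n)) w sequentially"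
      using Cauchy_uniformly_convergent unfolding uniformly_convergent_on_def by blast
    have "solves f {A..B} w"
      using \<phi>(1) * \<sigma> by (intro solves_limit[OF C1_on_continuous[OF f] A _ w]) auto
    moreover have "w A = \<gamma> x"
    proof (rule LIMSEQ_unique)
      show "(\<lambda>n. \<phi> (\<sigma> n) A) \<longlonglongrightarrow> w A"
        using tendsto_uniform_limitI[OF w] AB by simp
      have "(\<lambda>n. \<gamma> (\<sigma> n)) \<longlonglongrightarrow> \<gamma> x"
        unfolding \<gamma>_def by (intro tendsto_intros lim\<sigma>)
      then show "(\<lambda>n. \<phi> (\<sigma> n) A) \<longlonglongrightarrow> \<gamma> x"
        using \<phi>(2) * \<sigma> by simp
    qed
    ultimately show "E x"
      by (auto simp: E_def)
  qed (use that in auto)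
  show ?thesis
  proof (rule that)
    show "solves f {A..B} (\<phi> 1)" "\<phi> 1 A = q"
      using \<phi>[OF E[of 1]] by (auto simp: \<gamma>_def)
    show "norm (\<phi> 1 t - u t) \<le> B1 * B2 * exp ((\<rho> + e) * (t - A)) * norm (q - u A)"
      if "t \<in> {A..B}" for t
      using lip[of 0 1 t] E that \<phi>_unique[OF u _ that, of 0] by (auto simp: \<gamma>_def \<Lambda>_def)
  qed
qed

text \<open>By uniqueness, \<open>u\<close> is the solution reached from \<open>v\<close> in \<open>solution_from_any_point\<close>, for each \<open>e > 0\<close>.\<close>

theorem solutions_contract:
  assumes u: "solves f {A..B} u" and v: "solves f {A..B} v" and A: "0 \<le> A" and t: "t \<in> {A..B}"
  shows "norm (u t - v t) \<le> B1 * B2 * exp (\<rho> * (t - A)) * norm (u A - v A)"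
proof -
  have le: "norm (u t - v t) \<le> B1 * B2 * exp ((\<rho> + e) * (t - A)) * norm (u A - v A)" if e: "e > 0" for e
  proof -
    obtain w where w: "solves f {A..B} w" "w A = u A"
      "\<And>t. t \<in> {A..B} \<Longrightarrow> norm (w t - v t) \<le> B1 * B2 * exp ((\<rho> + e) * (t - A)) * norm (u A - v A)"
      using solution_from_any_point[OF v A _ e] t by (metis atLeastAtMost_iff order_trans)
    then show ?thesis
      using solution_unique[OF w(1) u A w(2) t] t by metis
  qed
  have "((\<lambda>e. B1 * B2 * exp ((\<rho> + e) * (t - A)) * norm (u A - v A)) \<longlongrightarrow>
      B1 * B2 * exp ((\<rho> + 0) * (t - A)) * norm (u A - v A)) (at_right 0)"
    by (intro tendsto_intros)
  moreover have "\<forall>\<^sub>F e in at_right 0. norm (u t - v t) \<le> B1 * B2 * exp ((\<rho> + e) * (t - A)) * norm (u A - v A)"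
    using le by (auto simp: eventually_at_right_field intro: exI[of _ 1])
  ultimately show ?thesis
    using tendsto_lowerbound[of _ _ "at_right (0::real)"] by fastforce
qed

text \<open>Near an instant \<open>x\<close>, the solution that passes through 0 at time \<open>x\<close> exists on some interval around \<open>x\<close>. By
  \<open>solution_from_any_point\<close> this one solution forces solutions from all initial values on the same interval,
  which is therefore independent of the initial value. Hence solutions do not blow up.\<close>

lemma solution_exists:
  assumes "0 \<le> a" "a \<le> b"
  obtains w where "solves f {a..b} w" "w a = q"
proof -
  define P where "P a b \<longleftrightarrow> (0 \<le> a \<and> a \<le> b \<longrightarrow> (\<forall>q. \<exists>w. solves f {a..b} w \<and> w a = q))" for a b
  have "P a b"
    using assms(2)
  proof (induction rule: Bolzano)
    case (trans a b c)
    show ?case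
      unfolding P_def
    proof (intro impI allI)
      fix q assume ac: "0 \<le> a \<and> a \<le> c"
      obtain w1 where w1: "solves f {a..b} w1" "w1 a = q"
        using trans ac unfolding P_def by blast
      have "0 \<le> b"
        using trans(3) ac by simp
      then obtain w2 where w2: "solves f {b..c} w2" "w2 b = w1 b"
        using trans unfolding P_def by blast
      show "\<exists>w. solves f {a..c} w \<and> w a = q"
        using solves_concat[OF w1(1) w2(1) w2(2)[symmetric] trans(3,4)] w1(2) trans(3)
        by (intro exI[of _ "\<lambda>t. if t \<le> b then w1 t else w2 t"]) auto
    qed
  next
    case (local x)
    then have "0 \<le> x"
      using assms by simp
    then obtain d r where d: "d > 0" "r > 0"
      "\<And>a b t0 q. \<lbrakk>0 \<le> a; a \<le> x; x \<le> b; b - a < d; t0 \<in> {a..b}; norm (q - 0) < r\<rbrakk> \<Longrightarrow>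
        \<exists>w. solves f {a..b} w \<and> w t0 = q \<and> (\<forall>t\<in>{a..b}. norm (w t - 0) < 1)"
      using C1_on_local_solution_exists[OF f _ zero_less_one, of x 0] by metis
    have "P a b" if ab: "a \<le> x" "x \<le> b" "b - a < d" for a b
      unfolding P_def
    proof (intro impI allI)
      fix q assume a: "0 \<le> a \<and> a \<le> b"
      then obtain u where "solves f {a..b} u"
        using d(3)[of a b a 0] ab d(2) by auto
      then show "\<exists>w. solves f {a..b} w \<and> w a = q"
        using solution_from_any_point[of a b u 1 q] a by (metis zero_less_one)
    qed
    then show ?case
      using d(1) by blast
  qed
  then show ?thesis
    using assms that unfolding P_def by blast
qed

text \<open>By uniqueness, the solutions on the intervals \<open>{0..T}\<close> fit together.\<close>

theorem propagator_exists:
  obtains \<phi> where "propagator f UNIV \<phi>"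
proof -
  define \<psi> where "\<psi> T q = (SOME w. solves f {0..T} w \<and> w 0 = q)" for T q
  have \<psi>: "solves f {0..T} (\<psi> T q)" "\<psi> T q 0 = q" if "0 \<le> T" for T q
  proof -
    have "\<exists>w. solves f {0..T} w \<and> w 0 = q"
      using solution_exists[of 0 T q] that by blast
    from someI_ex[OF this] show "solves f {0..T} (\<psi> T q)" "\<psi> T q 0 = q"
      by (auto simp: \<psi>_def)
  qed
  have unique: "w t = \<psi> t q t" if "solves f {0..T} w" "w 0 = q" "0 \<le> t" "t \<le> T" for w T q t
  proof (rule solution_unique[of 0 t w "\<psi> t q" t])
    show "solves f {0..t} w"
      using that(1) by (rule solves_subset) (use that(4) in auto)
  qed (use \<psi>[OF that(3), of q] that in auto)
  have "solves f {0..} (\<lambda>t. \<psi> t q t)" for q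
    unfolding solves_def
  proof
    fix t :: real assume "t \<in> {0..}"
    then have t: "0 \<le> t" "0 \<le> t + 1"
      by auto
    \<comment> \<open>The larger interval contains a neighbourhood of \<open>t\<close> in \<open>{0..}\<close>.\<close>
    have "solves f {0..t + 1} (\<lambda>s. \<psi> s q s)"
      by (rule solves_cong[OF \<psi>(1)[OF t(2)], of q]) (use unique[OF \<psi>[OF t(2)]] in auto)
    then have "((\<lambda>s. \<psi> s q s) has_vector_derivative f t (\<psi> t q t)) (at t within {0..t + 1})"
      using t by (auto simp: solves_def)
    moreover have "at t within {0..t + 1} = at t within {0..}"
      by (rule at_within_nhd[of _ "{..<t + 1}"]) auto
    ultimately show "((\<lambda>s. \<psi> s q s) has_vector_derivative f t (\<psi> t q t)) (at t within {0..})"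
      by simp
  qed
  moreover have "u t = \<psi> t q t" if "solves f {0..} u" "u 0 = q" "0 \<le> t" for u q t
    using that by (intro unique[of t]) (auto intro: solves_subset)
  ultimately have "propagator f UNIV (\<lambda>t q. \<psi> t q t)"
    using \<psi>(2)[of 0] by (auto simp: propagator_def)
  then show ?thesis
    by (rule that)
qed

theorem asymptotic_contraction:
  assumes "\<rho> < 0"
  shows "asymptotic_contraction_with_rate f UNIV \<rho>"
proof -
  obtain \<phi> where \<phi>: "propagator f UNIV \<phi>"
    by (rule propagator_exists)
  have "norm (\<phi> t u0 - \<phi> t v0) \<le> B1 * B2 * exp (\<rho> * t) * norm (u0 - v0)" if t: "0 \<le> t" for t u0 v0
  proof -
    have "solves f {0..t} (\<lambda>t. \<phi> t q)" "\<phi> 0 q = q" for q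
      using \<phi> by (auto simp: propagator_def intro: solves_subset)
    then show ?thesis
      using solutions_contract[of 0 t "\<lambda>t. \<phi> t u0" "\<lambda>t. \<phi> t v0" t] t by simp
  qed
  moreover have "((\<lambda>t. B1 * B2 * exp (\<rho> * t)) \<longlongrightarrow> B1 * B2 * 0) at_top"
    using assms by (intro tendsto_intros filterlim_compose[OF exp_at_bot]
        filterlim_tendsto_neg_mult_at_bot[OF tendsto_const] filterlim_ident)
  then have "\<exists>c\<ge>0. c < 1 \<and> ((\<lambda>t. B1 * B2 * exp (\<rho> * t)) \<longlongrightarrow> c) at_top"
    by (intro exI[of _ 0]) simp
  ultimately show ?thesis
    using \<phi> B_nonneg unfolding asymptotic_contraction_with_rate_def asymptotically_contracting_by_def
    by (intro exI[of _ "B1 * B2"]) auto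
qed

end

section \<open>Weighted contraction rates and the Cauchy problem\<close>

theorem theorem2:
  fixes f :: "real \<Rightarrow> 'v \<Rightarrow> 'v::banach"
    and \<Theta> :: "real \<Rightarrow> 'v \<Rightarrow> ('v \<Rightarrow>\<^sub>L 'w::banach)"
    and \<Theta>a :: "real \<Rightarrow> 'v \<Rightarrow> ('v \<Rightarrow>\<^sub>L 'a::banach)"
    and \<Theta>b :: "real \<Rightarrow> 'v \<Rightarrow> ('v \<Rightarrow>\<^sub>L 'b::banach)"
    and B1 B2 \<rho> :: real
  assumes f: "C1_on ({0..} \<times> UNIV) (\<lambda>(t, u). f t u)"
    and \<Theta>: "bounded_weight \<Theta> B1 B2"
  shows
    "(\<forall>t\<ge>0. \<forall>u. \<forall>\<Theta>' \<in> {time_deriv \<Theta> t u, flow_deriv f \<Theta> t u}.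
        weighted_rate (\<Theta> t u) \<Theta>' UNIV (state_deriv f t u) =
        rate (\<lambda>w. let v = inv (blinfun_apply (\<Theta> t u)) w
                   in \<Theta>' v + \<Theta> t u (state_deriv f t u v)))
     \<and>
     ((SUP (t, u)\<in>{0..} \<times> UNIV.
         weighted_rate (\<Theta> t u) (flow_deriv f \<Theta> t u) UNIV (state_deriv f t u)) \<le> ereal \<rho>
      \<longrightarrow>
        (\<forall>I u1 u2. is_interval I \<and> 0 \<in> I \<and> I \<subseteq> {0..} \<and> solves f I u1 \<and> solves f I u2 \<longrightarrow>
           (\<forall>t\<in>I. norm (u1 t - u2 t) \<le> B1 * B2 * exp (\<rho> * t) * norm (u1 0 - u2 0)) \<and>
           (\<forall>T. (\<forall>t\<ge>0. \<forall>u. \<Theta> t u = T) \<longrightarrow>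
              (\<forall>t\<in>I. norm (u1 t - u2 t)
                 \<le> condition_number T * exp (\<rho> * t) * norm (u1 0 - u2 0))))
        \<and>
        (\<rho> < 0 \<longrightarrow> asymptotic_contraction_with_rate f UNIV \<rho>))
     \<and>
     ((\<exists>A1 A2. bounded_weight \<Theta>a A1 A2) \<and> (\<exists>A1 A2. bounded_weight \<Theta>b A1 A2) \<longrightarrow>
        (\<forall>\<mu>. growth_bound f \<Theta>a \<mu> \<longrightarrow> growth_bound f \<Theta>b \<mu>))"
proof (intro conjI impI)
  show "\<forall>t\<ge>0. \<forall>u. \<forall>\<Theta>' \<in> {time_deriv \<Theta> t u, flow_deriv f \<Theta> t u}.
        weighted_rate (\<Theta> t u) \<Theta>' UNIV (state_deriv f t u) =
        rate (\<lambda>w. let v = inv (blinfun_apply (\<Theta> t u)) w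
                   in \<Theta>' v + \<Theta> t u (state_deriv f t u v))"
    using weighted_rate_eq_rate_conjugate[OF bounded_weight_bij[OF \<Theta>]] by blast
next
  assume sup: "(SUP (t, u)\<in>{0..} \<times> UNIV.
         weighted_rate (\<Theta> t u) (flow_deriv f \<Theta> t u) UNIV (state_deriv f t u)) \<le> ereal \<rho>"
  have rate: "weighted_rate (\<Theta> t u) (flow_deriv f \<Theta> t u) UNIV (state_deriv f t u) \<le> ereal \<rho>"
    if "0 \<le> t" for t u
    by (rule order_trans[OF SUP_upper2[of "(t, u)"] sup]) (use that in auto)
  have problem: "contracting_cauchy_problem f \<Theta> C1 C2 \<rho>" if "bounded_weight \<Theta> C1 C2" for C1 C2
    using f that rate by unfold_locales
  have contract: "norm (u1 t - u2 t) \<le> C1 * C2 * exp (\<rho> * t) * norm (u1 0 - u2 0)"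
    if "bounded_weight \<Theta> C1 C2" and I: "is_interval I" "0 \<in> I" "I \<subseteq> {0..}" "t \<in> I"
      and u: "solves f I u1" "solves f I u2" for C1 C2 I u1 u2 t
  proof -
    have "{0..t} \<subseteq> I"
      using mem_is_interval_1_I[OF I(1,2,4)] by auto
    then have "solves f {0..t} u1" "solves f {0..t} u2"
      using u by (auto intro: solves_subset)
    moreover have "t \<in> {0..t}"
      using I by auto
    ultimately show ?thesis
      using contracting_cauchy_problem.solutions_contract[OF problem[OF that(1)]] by fastforce
  qed
  show "\<forall>I u1 u2. is_interval I \<and> 0 \<in> I \<and> I \<subseteq> {0..} \<and> solves f I u1 \<and> solves f I u2 \<longrightarrow>
           (\<forall>t\<in>I. norm (u1 t - u2 t) \<le> B1 * B2 * exp (\<rho> * t) * norm (u1 0 - u2 0)) \<and>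
           (\<forall>T. (\<forall>t\<ge>0. \<forall>u. \<Theta> t u = T) \<longrightarrow>
              (\<forall>t\<in>I. norm (u1 t - u2 t)
                 \<le> condition_number T * exp (\<rho> * t) * norm (u1 0 - u2 0)))"
  proof (intro allI impI conjI ballI; elim conjE)
    fix I u1 u2 t
    assume "is_interval I" "0 \<in> I" "I \<subseteq> {0..}" "solves f I u1" "solves f I u2" "t \<in> I"
    then show "norm (u1 t - u2 t) \<le> B1 * B2 * exp (\<rho> * t) * norm (u1 0 - u2 0)"
      by (intro contract[OF \<Theta>])
  next
    fix I u1 u2 T t
    assume I: "is_interval I" "0 \<in> I" "I \<subseteq> {0..}" "solves f I u1" "solves f I u2" "t \<in> I"
      and T: "\<forall>t\<ge>0. \<forall>u. \<Theta> t u = T"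
    \<comment> \<open>For a constant weight, the optimal bounds are the norms of \<open>T\<close> and of its inverse.\<close>
    have "bounded_weight \<Theta> (norm T) (onorm (inv (blinfun_apply T)))"
      using \<Theta> T by (auto simp: bounded_weight_def)
    then show "norm (u1 t - u2 t) \<le> condition_number T * exp (\<rho> * t) * norm (u1 0 - u2 0)"
      unfolding condition_number_def using I by (intro contract)
  qed
  show "asymptotic_contraction_with_rate f UNIV \<rho>" if "\<rho> < 0"
    using contracting_cauchy_problem.asymptotic_contraction[OF problem[OF \<Theta>] that] .
next
  assume "(\<exists>A1 A2. bounded_weight \<Theta>a A1 A2) \<and> (\<exists>A1 A2. bounded_weight \<Theta>b A1 A2)"
  then show "\<forall>\<mu>. growth_bound f \<Theta>a \<mu> \<longrightarrow> growth_bound f \<Theta>b \<mu>"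
    using growth_bound_change_weight by blast
qed

end
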